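(* Let $k\ge 3$ be an integer with $k\equiv 1$ or $3\pmod 6$. There exists $n_0$ such that for every $n\ge n_0$ the following holds. Suppose that $\mathcal{H}$ is a cancellative $3$-graph on $n$ vertices with $|\partial\mathcal{H}| = t_{2}(n,k)$. Then $|\mathcal{H}|\le s(n,k)$, where \[ s(n,k)=\max\left\{|\mathcal{G}| : \mathcal{G} \text{ is a blowup of } \mathcal{S} \text{ for some } \mathcal{S}\in\mathrm{STS}(k) \text{ and } |V(\mathcal{G})|=n\right\}. \] Moreover, equality holds only if $\mathcal{H}$ is a blowup of $\mathcal{S}$ for some $\mathcal{S}\in\mathrm{STS}(k)$.
   Context: A $3$-graph $\mathcal{H}$ is cancellative if it does not contain three distinct edges $A,B,C$ with $A\triangle B\subseteq C$. The shadow is $\partial\mathcal{H}=\{A: |A|=2,\ A\subset B\text{ for some } B\in\mathcal{H}\}$. $t_2(n,k)$ is the number of edges of the Turán graph $T(n,k)$, the complete $k$-partite graph on $n$ vertices with part sizes $\lfloor n/k\rfloor$ or $\lceil n/k\rceil$. A Steiner triple system on $k$ vertices is a $3$-graph on $k$ vertices in which every pair of vertices lies in exactly one edge; $\mathrm{STS}(k)$ is the family of all of them. A $3$-graph $\mathcal{H}$ is a blowup of a $3$-graph $\mathcal{G}$ if there is a map $\psi:V(\mathcal{H})\to V(\mathcal{G})$ such that for every $3$-set $E\subseteq V(\mathcal{H})$, $\psi(E)\in\mathcal{G}$ if and only if $E\in\mathcal{H}$. *)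

theory Defs
  imports Main "HOL-Library.FuncSet"
begin

definition three_graph :: "'a set \<Rightarrow> 'a set set \<Rightarrow> bool" where
  "three_graph V H \<longleftrightarrow> finite V \<and> H \<subseteq> {E. E \<subseteq> V \<and> card E = 3}"

definition cancellative :: "'a set set \<Rightarrow> bool" where
  "cancellative H \<longleftrightarrow>
     \<not> (\<exists>A\<in>H. \<exists>B\<in>H. \<exists>C\<in>H. A \<noteq> B \<and> A \<noteq> C \<and> B \<noteq> C \<and> (A - B) \<union> (B - A) \<subseteq> C)"

definition shadow :: "'a set set \<Rightarrow> 'a set set" where
  "shadow H = {A. card A = 2 \<and> (\<exists>B\<in>H. A \<subset> B)}"

text \<open>The Turan graph on the vertex set \<open>{..<n}\<close>, whose parts are the residue classes modulo \<open>k\<close>;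
  the lemma below confirms that these have the prescribed sizes.\<close>

definition turan_part :: "nat \<Rightarrow> nat \<Rightarrow> nat \<Rightarrow> nat set" where
  "turan_part n k r = {i. i < n \<and> i mod k = r}"

definition turan_edges :: "nat \<Rightarrow> nat \<Rightarrow> nat set set" where
  "turan_edges n k = {{i, j} | i j r s.
     r < k \<and> s < k \<and> r \<noteq> s \<and> i \<in> turan_part n k r \<and> j \<in> turan_part n k s}"

definition t2 :: "nat \<Rightarrow> nat \<Rightarrow> nat" where
  "t2 n k = card (turan_edges n k)"

lemma card_turan_part:
  assumes "r < k"
  shows "card (turan_part n k r) = n div k + (if r < n mod k then 1 else 0)"
proof (induction n)
  case 0
  then show ?case by (simp add: turan_part_def)
next
  case (Suc n)
  have fin: "finite (turan_part n k r)" by (simp add: turan_part_def)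
  have "turan_part (Suc n) k r =
      (if n mod k = r then insert n (turan_part n k r) else turan_part n k r)"
    by (auto simp: turan_part_def less_Suc_eq)
  moreover have "n \<notin> turan_part n k r" by (simp add: turan_part_def)
  ultimately have "card (turan_part (Suc n) k r) =
      card (turan_part n k r) + (if n mod k = r then 1 else 0)"
    using fin by simp
  then show ?case
    using Suc assms mod_less_divisor[of k n] by (auto simp: div_Suc mod_Suc)
qed

definition steiner_triple_system :: "nat \<Rightarrow> 'a set \<Rightarrow> 'a set set \<Rightarrow> bool" where
  "steiner_triple_system k W S \<longleftrightarrow>
     three_graph W S \<and> card W = k \<and>
     (\<forall>P. P \<subseteq> W \<and> card P = 2 \<longrightarrow> (\<exists>!E. E \<in> S \<and> P \<subseteq> E))"

text \<open>\<open>blowup V H W G\<close>: the 3-graph \<open>H\<close> on \<open>V\<close> is a blowup of the 3-graph \<open>G\<close> on \<open>W\<close>.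
  The map need not be surjective, so parts may be empty.\<close>

definition blowup :: "'a set \<Rightarrow> 'a set set \<Rightarrow> 'b set \<Rightarrow> 'b set set \<Rightarrow> bool" where
  "blowup V H W G \<longleftrightarrow>
     (\<exists>\<psi> \<in> V \<rightarrow> W. \<forall>E. E \<subseteq> V \<and> card E = 3 \<longrightarrow> (\<psi> ` E \<in> G \<longleftrightarrow> E \<in> H))"

text \<open>All 3-graphs here are finite, so vertex sets that are sets of natural numbers
  represent every isomorphism type. For \<open>k\<close> congruent to 1 or 3 modulo 6 the maximum is over
  a nonempty set, because Steiner triple systems of these orders exist (Kirkman).\<close>

definition s_max :: "nat \<Rightarrow> nat \<Rightarrow> nat" where
  "s_max n k = Max {card G | (U :: nat set) G (W :: nat set) S.
     three_graph U G \<and> card U = n \<and> steiner_triple_system k W S \<and> blowup U G W S}"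

end

theory Submission
  imports Defs Complex_Main
begin

text \<open>Write \<open>a v\<close> for the number of vertices not adjacent to \<open>v\<close> in the shadow and \<open>d u v\<close> for the
  codegree of a pair. In a cancellative 3-graph the common neighbourhood of a pair is independent in
  the shadow, so \<open>d u v \<le> a w\<close> for every edge \<open>{u, v, w}\<close>. Summing
  \<open>a v / d u v + a w / d u w \<ge> 2\<close> over the edges bounds \<open>6 |H|\<close> by the sum of \<open>(n - a v) * a v\<close>
  over the vertices, hence, by convexity, by \<open>2 m n - 4 m\<^sup>2 / n\<close> where \<open>m\<close> is the size of the shadow.
  For \<open>m = t2 n k\<close> this exceeds \<open>6 * s_max n k\<close> by \<open>O(n)\<close> only. So if \<open>|H| \<ge> s_max n k\<close>, then all
  \<open>a v\<close> are close to \<open>n / k\<close>, and all but a bounded number of shadow pairs have codegree close to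
  \<open>n / k\<close>. The nonadjacency relation then splits the vertices into exactly \<open>k\<close> classes, and the pairs of
  large codegree define a Steiner triple system on the classes. Only a bounded number of edges of \<open>H\<close>
  can lie outside the corresponding blowup, whereas a single such edge forces linearly many
  edges of the blowup to be missing from \<open>H\<close>.\<close>

section \<open>Steiner triple systems and their blowups\<close>

text \<open>The exact value of \<open>s_max n k\<close> is never computed, and \<open>H\<close> is
  never compared with an optimal blowup. It is compared with \<open>ideal\<close>, the full blowup
  over classes read off from \<open>H\<close> itself, which \<open>s_max n k\<close> bounds from
  above by its definition as a maximum. A numerical estimate of \<open>s_max n k\<close> is needed
  only from below, to limit the slack; that estimate requires some triple system to exist, hence the
  proof of Kirkman's theorem. The slack has to be linear: upper and lower bound agree in the terms
  of order n^3 and n^2, so bad pairs, each costing order n, occur only boundedly often. An edge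
  outside \<open>ideal\<close> consists of bad pairs and is determined by two of them, so it is the
  square of the number of bad pairs that must stay below the linear threshold \<open>e\<close>. This
  condition dictates the size of \<open>n0\<close>.\<close>

lemma steiner_triple_system_image:
  assumes S: "steiner_triple_system k W S" and g: "bij_betw g W W'"
  shows "steiner_triple_system k W' ((`) g ` S)"
proof -
  have inj: "inj_on g W" and im: "g ` W = W'" using g by (auto simp: bij_betw_def)
  have fW: "finite W" and SW: "\<And>E. E \<in> S \<Longrightarrow> E \<subseteq> W \<and> card E = 3" and kW: "card W = k"
    and ex1: "\<And>P. P \<subseteq> W \<Longrightarrow> card P = 2 \<Longrightarrow> \<exists>!E. E \<in> S \<and> P \<subseteq> E"
    using S by (auto simp: steiner_triple_system_def three_graph_def)
  have "three_graph W' ((`) g ` S)"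
    using SW fW im by (auto simp: three_graph_def card_image inj_on_subset[OF inj])
  moreover have "card W' = k" using kW im card_image[OF inj] by simp
  moreover have "\<exists>!E. E \<in> (`) g ` S \<and> P \<subseteq> E" if P: "P \<subseteq> W'" "card P = 2" for P
  proof -
    obtain Q where Q: "Q \<subseteq> W" "P = g ` Q" using P im by (meson subset_imageE)
    then have "card Q = 2" using P card_image inj_on_subset[OF inj] by metis
    then obtain E where E: "E \<in> S" "Q \<subseteq> E" and un: "\<And>E'. E' \<in> S \<Longrightarrow> Q \<subseteq> E' \<Longrightarrow> E' = E"
      using ex1[OF Q(1)] by blast
    show ?thesis
    proof (rule ex1I[of _ "g ` E"])
      show "g ` E \<in> (`) g ` S \<and> P \<subseteq> g ` E" using E Q by auto
      fix F assume F: "F \<in> (`) g ` S \<and> P \<subseteq> F"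
      then obtain E' where E': "E' \<in> S" "F = g ` E'" by auto
      then have "Q \<subseteq> E'"
        using F Q(2) inj_on_image_mem_iff[OF inj _ conjunct1[OF SW[OF E'(1)]]] Q(1)
        by (metis imageI subset_iff)
      then show "F = g ` E" using un[OF E'(1)] E' by simp
    qed
  qed
  ultimately show ?thesis by (simp add: steiner_triple_system_def)
qed

lemma blowup_image_target:
  assumes b: "blowup V H W S" and g: "bij_betw g W W'" and S: "\<Union>S \<subseteq> W"
  shows "blowup V H W' ((`) g ` S)"
proof -
  have inj: "inj_on g W" and im: "g ` W = W'" using g by (auto simp: bij_betw_def)
  obtain p where p: "p \<in> V \<rightarrow> W" "\<And>E. E \<subseteq> V \<Longrightarrow> card E = 3 \<Longrightarrow> (p ` E \<in> S) = (E \<in> H)"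
    using b by (auto simp: blowup_def)
  have "((g \<circ> p) ` E \<in> (`) g ` S) = (E \<in> H)" if E: "E \<subseteq> V" "card E = 3" for E
  proof -
    have "p ` E \<subseteq> W" using p(1) E by auto
    then have "(g ` (p ` E) \<in> (`) g ` S) = (p ` E \<in> S)"
      using S inj_on_image_eq_iff[OF inj] by (auto simp: image_iff) (metis Union_upper subset_trans)
    then show ?thesis using p(2)[OF E] by (simp add: image_comp)
  qed
  moreover have "g \<circ> p \<in> V \<rightarrow> W'" using p(1) im by auto
  ultimately show ?thesis unfolding blowup_def by blast
qed

lemma blowup_image_source:
  assumes b: "blowup V H W S" and f: "bij_betw f V U" and H: "\<Union>H \<subseteq> V"
  shows "blowup U ((`) f ` H) W S"
proof -
  obtain p where p: "p \<in> V \<rightarrow> W" "\<And>E. E \<subseteq> V \<Longrightarrow> card E = 3 \<Longrightarrow> (p ` E \<in> S) = (E \<in> H)"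
    using b by (auto simp: blowup_def)
  have inj: "inj_on f V" and im: "f ` V = U" using f by (auto simp: bij_betw_def)
  define h where "h = p \<circ> inv_into V f"
  have "(h ` E \<in> S) = (E \<in> (`) f ` H)" if E: "E \<subseteq> U" "card E = 3" for E
  proof -
    obtain F where F: "F \<subseteq> V" "E = f ` F" using E im by (metis subset_imageE)
    have "h ` E = p ` F" using F inj
      unfolding h_def image_comp [symmetric] by (simp only: inv_into_image_cancel)
    moreover have "card F = 3" using E F card_image inj_on_subset[OF inj] by metis
    moreover have "(f ` F \<in> (`) f ` H) = (F \<in> H)"
      using H F inj_on_image_eq_iff[OF inj] by (auto simp: image_iff) (metis Union_upper subset_trans)
    ultimately show ?thesis using p(2)[OF F(1)] F by simp
  qed
  moreover have "h \<in> U \<rightarrow> W" using p(1) im inv_into_into[of _ f V] by (auto simp: h_def Pi_iff)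
  ultimately show ?thesis unfolding blowup_def by blast
qed

text \<open>\<open>Max\<close> is informative only over a finite set, so the sizes are capped by
  \<open>2 ^ n\<close>. The vertex types of \<open>V\<close> and \<open>W\<close> are arbitrary,
  whereas \<open>s_max\<close> ranges over sets of naturals; hence both sides are
  relabelled.\<close>

lemma card_le_s_max:
  assumes G: "three_graph V G" and n: "card V = n"
    and S: "steiner_triple_system k W S" and b: "blowup V G W S"
  shows "card G \<le> s_max n k"
proof -
  have fV: "finite V" and GV: "\<And>E. E \<in> G \<Longrightarrow> E \<subseteq> V \<and> card E = 3"
    using G by (auto simp: three_graph_def)
  have fW: "finite W" and SW: "\<Union>S \<subseteq> W"
    using S by (auto simp: steiner_triple_system_def three_graph_def)
  obtain f :: "_ \<Rightarrow> nat" where f: "bij_betw f V {0..<card V}"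
    using ex_bij_betw_finite_nat[OF fV] by blast
  obtain g :: "_ \<Rightarrow> nat" where g: "bij_betw g W {0..<card W}"
    using ex_bij_betw_finite_nat[OF fW] by blast
  let ?X = "{card G | (U :: nat set) G (W :: nat set) S.
     three_graph U G \<and> card U = n \<and> steiner_triple_system k W S \<and> blowup U G W S}"
  have inj: "inj_on f V" and im: "f ` V = {0..<card V}" using f by (auto simp: bij_betw_def)
  have "blowup {0..<card V} ((`) f ` G) {0..<card W} ((`) g ` S)"
    using blowup_image_source[OF blowup_image_target[OF b g SW] f] GV by blast
  moreover have "three_graph {0..<card V} ((`) f ` G)"
    unfolding three_graph_def
    using GV im by (auto simp: card_image inj_on_subset[OF inj])
  moreover have "card ((`) f ` G) = card G"
    by (rule card_image, rule inj_onI) (meson GV inj inj_on_image_eq_iff)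
  ultimately have "card G \<in> ?X"
    using steiner_triple_system_image[OF S g] n
    by (smt (verit, best) card_atLeastLessThan diff_zero mem_Collect_eq)
  moreover have "?X \<subseteq> {..2 ^ n}"
  proof
    fix x assume "x \<in> ?X"
    then obtain U :: "nat set" and G where *: "x = card G" "three_graph U G" "card U = n" by blast
    then have "G \<subseteq> Pow U" "finite U" by (auto simp: three_graph_def)
    then have "card G \<le> 2 ^ n" using card_mono[of "Pow U" G] * by (simp add: card_Pow)
    then show "x \<in> {..2 ^ n}" using * by simp
  qed
  then have "finite ?X" using finite_subset by blast
  ultimately show ?thesis unfolding s_max_def by (intro Max_ge)
qed

section \<open>Counting with ordered pairs\<close>

definition offdiag :: "'a set \<Rightarrow> ('a \<times> 'a) set" where
  "offdiag A = {(x, y). x \<in> A \<and> y \<in> A \<and> x \<noteq> y}"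

lemma finite_offdiag [simp]: "finite A \<Longrightarrow> finite (offdiag A)"
  by (rule finite_subset[of _ "A \<times> A"]) (auto simp: offdiag_def)

lemma card_offdiag:
  assumes "finite A" shows "card (offdiag A) + card A = card A ^ 2"
proof -
  have "A \<times> A = offdiag A \<union> (\<lambda>x. (x, x)) ` A" by (auto simp: offdiag_def)
  moreover have "offdiag A \<inter> (\<lambda>x. (x, x)) ` A = {}" by (auto simp: offdiag_def)
  moreover have "card ((\<lambda>x. (x, x)) ` A) = card A" by (rule card_image) (auto simp: inj_on_def)
  ultimately show ?thesis
    using card_Un_disjoint[of "offdiag A" "(\<lambda>x. (x, x)) ` A"] assms card_cartesian_product[of A A]
    by (simp only: finite_imageI finite_offdiag power2_eq_square)
qed

lemma card_ordered_pairs: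
  assumes "finite E" "\<And>e. e \<in> E \<Longrightarrow> card e = 2"
  shows "card {(u, v). {u, v} \<in> E} = 2 * card E"
proof -
  have "{(u, v). {u, v} \<in> E} = (\<Union>e\<in>E. offdiag e)"
  proof (intro equalityI subsetI)
    fix p assume "p \<in> {(u, v). {u, v} \<in> E}"
    then obtain u v where p: "p = (u, v)" "{u, v} \<in> E" by auto
    then have "u \<noteq> v" using assms(2)[of "{u, v}"] by auto
    then show "p \<in> (\<Union>e\<in>E. offdiag e)" using p by (auto simp: offdiag_def)
  next
    fix p assume "p \<in> (\<Union>e\<in>E. offdiag e)"
    then obtain u v e where p: "p = (u, v)" "e \<in> E" "u \<in> e" "v \<in> e" "u \<noteq> v"
      by (auto simp: offdiag_def)
    then have "e = {u, v}" using assms(2)[of e] by (auto simp: card_2_iff)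
    then show "p \<in> {(u, v). {u, v} \<in> E}" using p by simp
  qed
  moreover have "card (\<Union>e\<in>E. offdiag e) = (\<Sum>e\<in>E. card (offdiag e))"
  proof (rule card_UN_disjoint)
    show "\<forall>i\<in>E. finite (offdiag i)" using assms by (metis card.infinite finite_offdiag zero_neq_numeral)
    show "\<forall>i\<in>E. \<forall>j\<in>E. i \<noteq> j \<longrightarrow> offdiag i \<inter> offdiag j = {}"
    proof (intro ballI impI)
      fix i j assume "i \<in> E" "j \<in> E" "i \<noteq> j"
      then have "card i = 2" "card j = 2" using assms by auto
      then show "offdiag i \<inter> offdiag j = {}" using \<open>i \<noteq> j\<close>
        by (auto simp: card_2_iff offdiag_def)
    qed
  qed (use assms in auto)
  moreover have "card (offdiag e) = 2" if "e \<in> E" for e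
  proof -
    have "card e = 2" using assms that by auto
    moreover have "finite e" using \<open>card e = 2\<close> by (metis card.infinite zero_neq_numeral)
    ultimately show ?thesis using card_offdiag[of e] by simp
  qed
  ultimately show ?thesis by simp
qed

text \<open>The sets \<open>offdiag E\<close> of the triples partition \<open>offdiag W\<close>.
  Sums over triples thus become sums over pairs, whichever system is used.\<close>

lemma sum_steiner_triple_system:
  fixes f :: "'a \<Rightarrow> 'a \<Rightarrow> 'b::comm_monoid_add"
  assumes S: "steiner_triple_system k W S"
  shows "(\<Sum>E\<in>S. \<Sum>(x, y)\<in>offdiag E. f x y) = (\<Sum>(x, y)\<in>offdiag W. f x y)"
proof -
  have fW: "finite W" and SW: "\<And>E. E \<in> S \<Longrightarrow> E \<subseteq> W \<and> card E = 3"
    and ex1: "\<And>P. P \<subseteq> W \<Longrightarrow> card P = 2 \<Longrightarrow> \<exists>!E. E \<in> S \<and> P \<subseteq> E"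
    using S by (auto simp: steiner_triple_system_def three_graph_def)
  have fS: "finite S" using fW SW by (meson Pow_iff finite_Pow_iff finite_subset subsetI)
  have "(\<Union>E\<in>S. offdiag E) = offdiag W"
  proof (intro equalityI subsetI)
    fix p assume "p \<in> (\<Union>E\<in>S. offdiag E)" then show "p \<in> offdiag W" using SW
      by (auto simp: offdiag_def)
  next
    fix p assume "p \<in> offdiag W"
    then obtain x y where p: "p = (x, y)" "x \<in> W" "y \<in> W" "x \<noteq> y" by (auto simp: offdiag_def)
    then obtain E where "E \<in> S" "{x, y} \<subseteq> E" using ex1[of "{x, y}"] by auto
    then show "p \<in> (\<Union>E\<in>S. offdiag E)" using p by (auto simp: offdiag_def)
  qed
  moreover have "offdiag E \<inter> offdiag E' = {}" if "E \<in> S" "E' \<in> S" "E \<noteq> E'" for E E'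
  proof (rule ccontr)
    assume "offdiag E \<inter> offdiag E' \<noteq> {}"
    then obtain x y where "x \<noteq> y" "{x, y} \<subseteq> E" "{x, y} \<subseteq> E'" by (auto simp: offdiag_def)
    moreover from this have "\<exists>!E. E \<in> S \<and> {x, y} \<subseteq> E" using ex1[of "{x, y}"] SW that by auto
    ultimately show False using that by blast
  qed
  moreover have "\<forall>E\<in>S. finite (offdiag E)" using SW fW finite_subset finite_offdiag by metis
  ultimately show ?thesis using sum.UNION_disjoint[OF fS, of offdiag "\<lambda>(x, y). f x y"] by simp
qed

lemma sum_offdiag_fst:
  fixes f :: "'a \<Rightarrow> nat"
  assumes "finite A"
  shows "(\<Sum>(x, y)\<in>offdiag A. f x) = (card A - 1) * (\<Sum>x\<in>A. f x)"
proof -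
  have "offdiag A = (SIGMA x:A. A - {x})" by (auto simp: offdiag_def)
  then have "(\<Sum>(x, y)\<in>offdiag A. f x) = (\<Sum>x\<in>A. \<Sum>y\<in>A - {x}. f x)"
    using assms sum.Sigma[of A "\<lambda>x. A - {x}" "\<lambda>x y. f x"] by (simp add: prod.case_distrib)
  also have "\<dots> = (\<Sum>x\<in>A. (card A - 1) * f x)" using assms by (intro sum.cong) auto
  finally show ?thesis by (simp add: sum_distrib_left)
qed

text \<open>The witness is the blowup whose parts are the residue classes modulo \<open>k\<close>,
  of sizes \<open>q + e i\<close> with \<open>e i\<close> at most 1. The factor 6, the number of
  ordered pairs in a triple, avoids division.\<close>

lemma s_max_lower_bound:
  assumes S: "steiner_triple_system k W S" and k: "k > 0"
  shows "k * (k - 1) * (n div k) ^ 3 + 3 * (k - 1) * (n mod k) * (n div k) ^ 2 \<le> 6 * s_max n k"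
proof -
  have "finite W" "card W = k" using S by (auto simp: steiner_triple_system_def three_graph_def)
  then obtain g :: "_ \<Rightarrow> nat" where g: "bij_betw g W {0..<k}"
    using ex_bij_betw_finite_nat by blast
  define R where "R = (`) g ` S"
  define q where "q = n div k"
  define e where "e i = (if i < n mod k then 1 else 0 :: nat)" for i
  have R: "steiner_triple_system k {0..<k} R"
    using steiner_triple_system_image[OF S g] by (simp add: R_def)
  have RW: "\<And>E. E \<in> R \<Longrightarrow> E \<subseteq> {0..<k} \<and> card E = 3"
    using R by (auto simp: steiner_triple_system_def three_graph_def)
  then have "R \<subseteq> Pow {0..<k}" by blast
  then have fR: "finite R" by (rule finite_subset) simp
  define F where "F T = {E. E \<subseteq> {..<n} \<and> card E = 3 \<and> (\<lambda>i. i mod k) ` E = T}" for T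
  define G where "G = {E. E \<subseteq> {..<n} \<and> card E = 3 \<and> (\<lambda>i. i mod k) ` E \<in> R}"
  have G: "three_graph {..<n} G" by (auto simp: three_graph_def G_def)
  have "blowup {..<n} G {0..<k} R" unfolding blowup_def G_def
    using k by (intro bexI[of _ "\<lambda>i. i mod k"]) auto
  then have Gs: "card G \<le> s_max n k" using card_le_s_max[OF G _ R] by simp
  have finF: "finite (F T)" for T by (rule finite_subset[of _ "Pow {..<n}"]) (auto simp: F_def)
  have "G = (\<Union>T\<in>R. F T)" by (auto simp: G_def F_def)
  moreover have disj: "\<forall>T\<in>R. \<forall>T'\<in>R. T \<noteq> T' \<longrightarrow> F T \<inter> F T' = {}" by (auto simp: F_def)
  ultimately have cG: "card G = (\<Sum>T\<in>R. card (F T))"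
    using card_UN_disjoint[OF fR, of F] finF disj by simp
  \<comment> \<open>From (q + e a)(q + e b)(q + e c) only the terms of order q^3 and q^2 are kept;
    the rest is linear in q. Each point is the first entry of two ordered pairs of \<open>T\<close>,
    so the factor 3 restores the common multiple 6.\<close>
  have cF: "(\<Sum>(x, y)\<in>offdiag T. q ^ 3) + 3 * (\<Sum>(x, y)\<in>offdiag T. q ^ 2 * e x) \<le> 6 * card (F T)"
    if T: "T \<in> R" for T
  proof -
    obtain a b c where abc: "T = {a, b, c}" "a \<noteq> b" "a \<noteq> c" "b \<noteq> c"
      using RW[OF T] by (auto simp: card_3_iff)
    then have lt: "a < k" "b < k" "c < k" using RW[OF T] by auto
    let ?P = "turan_part n k"
    let ?f = "\<lambda>(x, y, z). {x, y, z :: nat}"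
    have "inj_on ?f (?P a \<times> ?P b \<times> ?P c)"
    proof (rule inj_onI)
      fix t t' assume t: "t \<in> ?P a \<times> ?P b \<times> ?P c" "t' \<in> ?P a \<times> ?P b \<times> ?P c" "?f t = ?f t'"
      obtain x y z where t1: "t = (x, y, z)" by (rule prod_cases3)
      obtain x' y' z' where t2: "t' = (x', y', z')" by (rule prod_cases3)
      have m: "x mod k = a" "y mod k = b" "z mod k = c" "x' mod k = a" "y' mod k = b" "z' mod k = c"
        using t(1,2) unfolding t1 t2 turan_part_def by simp_all
      have s: "{x, y, z} = {x', y', z'}" using t(3) unfolding t1 t2 by simp
      have "x \<in> {x', y', z'}" "y \<in> {x', y', z'}" "z \<in> {x', y', z'}"
        unfolding s [symmetric] by simp_all
      then have "x = x'" "y = y'" "z = z'" using m abc(2-4) by auto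
      then show "t = t'" using t1 t2 by simp
    qed
    moreover have "?f ` (?P a \<times> ?P b \<times> ?P c) \<subseteq> F T"
    proof
      fix E assume "E \<in> ?f ` (?P a \<times> ?P b \<times> ?P c)"
      then obtain x y z where E: "E = {x, y, z}" and "x \<in> ?P a" "y \<in> ?P b" "z \<in> ?P c" by auto
      then have "x < n" "y < n" "z < n" "x mod k = a" "y mod k = b" "z mod k = c"
        by (auto simp: turan_part_def)
      moreover from this have "x \<noteq> y" "x \<noteq> z" "y \<noteq> z" using abc by auto
      ultimately show "E \<in> F T" unfolding F_def abc(1) E by simp
    qed
    ultimately have "card (?P a \<times> ?P b \<times> ?P c) \<le> card (F T)"
      by (rule card_inj_on_le[OF _ _ finF])
    then have "(q + e a) * ((q + e b) * (q + e c)) \<le> card (F T)"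
      using lt by (simp add: card_cartesian_product card_turan_part q_def e_def)
    moreover have "q ^ 3 + q ^ 2 * (e a + e b + e c) \<le> (q + e a) * ((q + e b) * (q + e c))"
      by (simp add: algebra_simps power2_eq_square power3_eq_cube)
    moreover have od: "offdiag T = {(a,b),(b,a),(a,c),(c,a),(b,c),(c,b)}"
      unfolding abc(1) offdiag_def using abc(2-4) by blast
    moreover have "(\<Sum>(x, y)\<in>offdiag T. q ^ 3) = 6 * q ^ 3"
       "(\<Sum>(x, y)\<in>offdiag T. q ^ 2 * e x) = 2 * (q ^ 2 * (e a + e b + e c))"
      unfolding od using abc(2-4) by (simp_all add: distrib_left)
    ultimately show ?thesis by linarith
  qed
  have "n mod k < k" using k by simp
  then have "{0..<k} \<inter> {i. i < n mod k} = {0..<n mod k}" by auto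
  then have se: "(\<Sum>x\<in>{0..<k}. e x) = n mod k"
    unfolding e_def by (subst sum.If_cases) simp_all
  have "(\<Sum>T\<in>R. \<Sum>(x, y)\<in>offdiag T. q ^ 3) = (\<Sum>(x, y)\<in>offdiag {0..<k}. q ^ 3)"
    by (rule sum_steiner_triple_system[OF R])
  also have "\<dots> = (k - 1) * (k * q ^ 3)"
    using sum_offdiag_fst[of "{0..<k}" "\<lambda>_. q ^ 3"] by simp
  finally have 1: "(\<Sum>T\<in>R. \<Sum>(x, y)\<in>offdiag T. q ^ 3) = (k - 1) * (k * q ^ 3)" .
  have "(\<Sum>T\<in>R. \<Sum>(x, y)\<in>offdiag T. q ^ 2 * e x) = (\<Sum>(x, y)\<in>offdiag {0..<k}. q ^ 2 * e x)"
    by (rule sum_steiner_triple_system[OF R])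
  also have "\<dots> = (k - 1) * (q ^ 2 * (n mod k))"
    using sum_offdiag_fst[of "{0..<k}" "\<lambda>x. q ^ 2 * e x"] se by (simp add: sum_distrib_left [symmetric])
  finally have 2: "(\<Sum>T\<in>R. \<Sum>(x, y)\<in>offdiag T. q ^ 2 * e x) = (k - 1) * (q ^ 2 * (n mod k))" .
  have "(\<Sum>T\<in>R. (\<Sum>(x, y)\<in>offdiag T. q ^ 3) + 3 * (\<Sum>(x, y)\<in>offdiag T. q ^ 2 * e x)) \<le> 6 * card G"
    unfolding cG sum_distrib_left by (rule sum_mono) (use cF in \<open>auto simp: sum_distrib_left\<close>)
  then have "(k - 1) * (k * q ^ 3) + 3 * ((k - 1) * (q ^ 2 * (n mod k))) \<le> 6 * card G"
    using 1 2 by (simp add: sum.distrib sum_distrib_left [symmetric])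
  also have "\<dots> \<le> 6 * s_max n k" using Gs by simp
  also have "(k - 1) * (k * q ^ 3) + 3 * ((k - 1) * (q ^ 2 * (n mod k))) =
      k * (k - 1) * q ^ 3 + 3 * (k - 1) * (n mod k) * q ^ 2" by (simp add: mult_ac)
  finally show ?thesis unfolding q_def .
qed

section \<open>Existence of Steiner triple systems\<close>

lemma sum_card_containing_pair:
  assumes S: "three_graph W S"
  shows "(\<Sum>p\<in>offdiag W. card {E \<in> S. p \<in> offdiag E}) = 6 * card S"
proof -
  have fW: "finite W" and SW: "\<And>E. E \<in> S \<Longrightarrow> E \<subseteq> W \<and> card E = 3"
    using S by (auto simp: three_graph_def)
  have "S \<subseteq> Pow W" using SW by blast
  then have fS: "finite S" using fW by (simp add: finite_subset)
  have "(\<Sum>p\<in>offdiag W. card {E \<in> S. p \<in> offdiag E}) =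
      (\<Sum>p\<in>offdiag W. \<Sum>E\<in>S. if p \<in> offdiag E then 1 else 0)"
  proof (rule sum.cong[OF refl])
    fix p
    have "S \<inter> {E. p \<in> offdiag E} = {E \<in> S. p \<in> offdiag E}" by blast
    then show "card {E \<in> S. p \<in> offdiag E} = (\<Sum>E\<in>S. if p \<in> offdiag E then 1 else 0)"
      using fS by (subst sum.If_cases) simp_all
  qed
  also have "\<dots> = (\<Sum>E\<in>S. \<Sum>p\<in>offdiag W. if p \<in> offdiag E then 1 else 0)"
    by (rule sum.swap)
  also have "\<dots> = (\<Sum>E\<in>S. 6)"
  proof (rule sum.cong[OF refl])
    fix E assume E: "E \<in> S"
    have "finite E" using SW[OF E] fW finite_subset[of E W] by simp
    then have "card (offdiag E) = 6" using card_offdiag[of E] SW[OF E] by simp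
    moreover have "offdiag W \<inter> {p. p \<in> offdiag E} = offdiag E"
      using SW[OF E] by (auto simp: offdiag_def)
    ultimately show "(\<Sum>p\<in>offdiag W. if p \<in> offdiag E then 1 else 0) = (6 :: nat)"
      using fW by (subst sum.If_cases) simp_all
  qed
  finally show ?thesis by simp
qed

text \<open>The number of triples is so small that no pair can be covered twice.\<close>

lemma steiner_triple_system_if_covering:
  assumes S: "three_graph W S" and k: "card W = k"
    and cover: "\<And>x y. x \<in> W \<Longrightarrow> y \<in> W \<Longrightarrow> x \<noteq> y \<Longrightarrow> \<exists>E\<in>S. {x, y} \<subseteq> E"
    and few: "6 * card S \<le> k * (k - 1)"
  shows "steiner_triple_system k W S"
proof -
  have fW: "finite W" and SW: "\<And>E. E \<in> S \<Longrightarrow> E \<subseteq> W \<and> card E = 3"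
    using S by (auto simp: three_graph_def)
  have "S \<subseteq> Pow W" using SW by blast
  then have fS: "finite S" using fW by (simp add: finite_subset)
  define c where "c p = card {E \<in> S. p \<in> offdiag E}" for p
  have cpos: "c p \<ge> 1" if pW: "p \<in> offdiag W" for p
  proof -
    obtain x y where p: "p = (x, y)" by (rule prod.exhaust)
    then have xy: "x \<in> W" "y \<in> W" "x \<noteq> y" using pW by (auto simp: offdiag_def)
    then obtain E where "E \<in> S" "{x, y} \<subseteq> E" using cover by blast
    then have "E \<in> {E \<in> S. p \<in> offdiag E}" using xy p by (simp add: offdiag_def)
    then have "{E \<in> S. p \<in> offdiag E} \<noteq> {}" by blast
    then have "c p \<noteq> 0" using fS by (simp add: c_def)
    then show ?thesis by simp
  qed
  have od: "card (offdiag W) = k * (k - 1)"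
  proof -
    have "card (offdiag W) + k = k * k" using card_offdiag[OF fW] k by (simp add: power2_eq_square)
    moreover have "k * (k - 1) = k * k - k" by (simp add: right_diff_distrib')
    ultimately show ?thesis by linarith
  qed
  have "(\<Sum>p\<in>offdiag W. c p) = 6 * card S"
    unfolding c_def by (rule sum_card_containing_pair[OF S])
  then have le: "(\<Sum>p\<in>offdiag W. c p) \<le> (\<Sum>p\<in>offdiag W. 1)"
    using few by (simp add: od)
  have c1: "c p = 1" if "p \<in> offdiag W" for p
  proof -
    have "\<not> 1 < c p"
    proof
      assume "1 < c p"
      then have ex: "\<exists>p\<in>offdiag W. 1 < c p" using that by (rule bexI)
      have "(\<Sum>p\<in>offdiag W. 1) < (\<Sum>p\<in>offdiag W. c p)"
        by (rule sum_strict_mono_ex1[OF finite_offdiag[OF fW] ballI ex]) (rule cpos)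
      then show False using le by simp
    qed
    then show ?thesis using cpos[OF that] by simp
  qed
  have "\<exists>!E. E \<in> S \<and> P \<subseteq> E" if P: "P \<subseteq> W" "card P = 2" for P
  proof -
    obtain x y where xy: "P = {x, y}" "x \<noteq> y" using P by (auto simp: card_2_iff)
    have "card {E \<in> S. (x, y) \<in> offdiag E} = 1"
    proof -
      have "(x, y) \<in> offdiag W" using P xy by (simp add: offdiag_def)
      then have "c (x, y) = 1" by (rule c1)
      then show ?thesis by (simp only: c_def)
    qed
    moreover have "{E \<in> S. (x, y) \<in> offdiag E} = {E \<in> S. P \<subseteq> E}"
      using xy by (auto simp: offdiag_def)
    ultimately have "card {E \<in> S. P \<subseteq> E} = 1" by (simp only:)
    then obtain E where E: "{E \<in> S. P \<subseteq> E} = {E}" by (rule card_1_singletonE)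
    have "E' \<in> S \<and> P \<subseteq> E' \<longleftrightarrow> E' = E" for E' using E by (simp add: set_eq_iff)
    then show ?thesis by simp
  qed
  then show ?thesis using S k by (simp add: steiner_triple_system_def)
qed

text \<open>An upper bound is all that the covering criterion asks for. Commutativity of
  \<open>f\<close> makes a triple depend only on an unordered pair and a level; \<open>Min\<close>
  and \<open>Max\<close> pick an order of the pair.\<close>

lemma card_mixed_triples:
  fixes f :: "nat \<Rightarrow> nat \<Rightarrow> nat"
  assumes comm: "\<And>x y. f x y = f y x"
  shows "card {{(x, i), (y, i), (f x y, Suc i mod 3)} | x y i. x < N \<and> y < N \<and> x \<noteq> y \<and> i < (3::nat)} \<le>
    3 * (N * (N - 1) div 2)"
proof -
  let ?D = "{e. e \<subseteq> {0..<N} \<and> card e = 2}"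
  define F where "F = (\<lambda>(e, i). {(Min e, i), (Max e, i), (f (Min e) (Max e), Suc i mod 3)})"
  have fin: "finite (?D \<times> {0..<3::nat})" by simp
  have "{{(x, i), (y, i), (f x y, Suc i mod 3)} | x y i. x < N \<and> y < N \<and> x \<noteq> y \<and> i < 3}
    \<subseteq> F ` (?D \<times> {0..<3})"
  proof
    fix E assume "E \<in> {{(x, i), (y, i), (f x y, Suc i mod 3)} | x y i. x < N \<and> y < N \<and> x \<noteq> y \<and> i < 3}"
    then obtain x y i where E: "E = {(x, i), (y, i), (f x y, Suc i mod 3)}" "x < N" "y < N" "x \<noteq> y" "i < 3"
      by blast
    have "E = F ({x, y}, i)"
    proof (cases "x < y")
      case True then show ?thesis by (simp add: E(1) F_def)
    next
      case False then show ?thesis using E(4) comm[of x y] by (auto simp: E(1) F_def min_def max_def)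
    qed
    moreover have "({x, y}, i) \<in> ?D \<times> {0..<3}" using E by simp
    ultimately show "E \<in> F ` (?D \<times> {0..<3})" by blast
  qed
  then have "card {{(x, i), (y, i), (f x y, Suc i mod 3)} | x y i. x < N \<and> y < N \<and> x \<noteq> y \<and> i < 3}
    \<le> card (F ` (?D \<times> {0..<3}))" using fin by (intro card_mono) auto
  also have "\<dots> \<le> card (?D \<times> {0..<3::nat})" using fin by (rule card_image_le)
  also have "\<dots> = 3 * (N choose 2)" using n_subsets[of "{0..<N}" 2]
    by (simp add: card_cartesian_product)
  finally show ?thesis by (simp add: choose_two)
qed

text \<open>The three levels are arranged cyclically, so two distinct ones are consecutive in one of
  the two directions. Covering of pairs is then checked within a level and from a level to the
  next.\<close>

lemma level_cases:
  assumes "i < 3" "j < (3::nat)"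
  shows "i = j \<or> j = Suc i mod 3 \<or> i = Suc j mod 3"
proof -
  have "i = 0 \<or> i = 1 \<or> i = 2" "j = 0 \<or> j = 1 \<or> j = 2" using assms by linarith+
  then show ?thesis by (elim disjE) simp_all
qed

text \<open>To be applied to \<open>f x y = (x + y) / 2\<close> modulo the odd number \<open>N\<close>.\<close>

lemma bose_construction:
  fixes f :: "nat \<Rightarrow> nat \<Rightarrow> nat"
  assumes comm: "\<And>x y. f x y = f y x" and cl: "\<And>x y. x < N \<Longrightarrow> y < N \<Longrightarrow> f x y < N"
    and div: "\<And>x z. x < N \<Longrightarrow> z < N \<Longrightarrow> \<exists>y<N. f x y = z"
    and idem: "\<And>x. x < N \<Longrightarrow> f x x = x" and N: "odd N"
  shows "\<exists>S. steiner_triple_system (3 * N) ({0..<N} \<times> {0..<3::nat}) S"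
proof -
  let ?W = "{0..<N} \<times> {0..<3::nat}"
  define S1 where "S1 = (\<lambda>x. {(x, 0), (x, 1), (x, 2::nat)}) ` {0..<N}"
  define S2 where "S2 = {{(x, i), (y, i), (f x y, Suc i mod 3)} | x y i. x < N \<and> y < N \<and> x \<noteq> y \<and> i < (3::nat)}"
  have i3: "i \<noteq> Suc i mod 3" if "i < 3" for i :: nat using that by (auto simp: mod_Suc)
  have W: "three_graph ?W (S1 \<union> S2)" unfolding three_graph_def
  proof (intro conjI subsetI)
    fix E assume "E \<in> S1 \<union> S2"
    then show "E \<in> {E. E \<subseteq> ?W \<and> card E = 3}"
    proof
      assume "E \<in> S1" then show ?thesis by (auto simp: S1_def)
    next
      assume "E \<in> S2"
      then obtain x y i where "E = {(x, i), (y, i), (f x y, Suc i mod 3)}" "x < N" "y < N" "x \<noteq> y" "i < 3"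
        unfolding S2_def by blast
      then show ?thesis using cl i3[of i] by simp
    qed
  qed simp
  \<comment> \<open>Solving \<open>f x y = z\<close> supplies the partner \<open>y\<close> of
    \<open>x\<close> on its level. If \<open>y = x\<close> there is no mixed triple, but then
    \<open>z = x\<close> by idempotency and the vertical triple of \<open>x\<close> covers the
    pair.\<close>
  have up: "\<exists>E\<in>S1 \<union> S2. {(x, i), (z, Suc i mod 3)} \<subseteq> E" if x: "x < N" "z < N" "i < 3" for x z i
  proof -
    obtain y where y: "y < N" "f x y = z" using div x by blast
    show ?thesis
    proof (cases "x = y")
      case True
      then have "z = x" using idem y by simp
      then have "{(x, i), (z, Suc i mod 3)} \<subseteq> {(x, 0), (x, 1), (x, 2)}"
        using x(3) by (auto simp: mod_Suc)
      then show ?thesis using x by (intro bexI[of _ "{(x, 0), (x, 1), (x, 2)}"]) (auto simp: S1_def)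
    next
      case False
      then have "{(x, i), (y, i), (f x y, Suc i mod 3)} \<in> S2" using x y unfolding S2_def by blast
      then show ?thesis using y by (intro bexI[of _ "{(x, i), (y, i), (f x y, Suc i mod 3)}"]) auto
    qed
  qed
  have "\<exists>E\<in>S1 \<union> S2. {p, p'} \<subseteq> E" if p: "p \<in> ?W" "p' \<in> ?W" "p \<noteq> p'" for p p'
  proof -
    obtain x i z j where q: "p = (x, i)" "p' = (z, j)" "x < N" "i < 3" "z < N" "j < 3" using p(1,2) by auto
    consider "i = j" | "j = Suc i mod 3" | "i = Suc j mod 3"
      using level_cases[OF q(4,6)] by blast
    then show ?thesis
    proof cases
      case 1
      then have "{(x, i), (z, i), (f x z, Suc i mod 3)} \<in> S2" using p q unfolding S2_def by blast
      then show ?thesis using q 1 by (intro bexI[of _ "{(x, i), (z, i), (f x z, Suc i mod 3)}"]) auto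
    next
      case 2 then show ?thesis using up[of x z i] q by simp
    next
      case 3 then show ?thesis using up[of z x j] q by (simp add: insert_commute)
    qed
  qed
  \<comment> \<open>The count is tight: six times N + 3 N (N - 1) / 2 is the number of ordered pairs
    of distinct points.\<close>
  moreover have "6 * card (S1 \<union> S2) \<le> 3 * N * (3 * N - 1)"
  proof -
    have "card (S1 \<union> S2) \<le> card S1 + card S2" by (rule card_Un_le)
    also have "card S1 \<le> N" unfolding S1_def using card_image_le[of "{0..<N}"] by simp
    also have "card S2 \<le> 3 * (N * (N - 1) div 2)" unfolding S2_def by (rule card_mixed_triples[OF comm])
    finally have *: "card (S1 \<union> S2) \<le> N + 3 * (N * (N - 1) div 2)" by simp
    obtain t where t: "N = 2 * t + 1" using N by (rule oddE)
    then have "N * (N - 1) div 2 = N * t" by simp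
    then have "6 * card (S1 \<union> S2) \<le> 6 * (N + 3 * (N * t))" using * by simp
    also have "\<dots> = 3 * N * (3 * N - 1)" unfolding t by (simp add: algebra_simps)
    finally show ?thesis .
  qed
  ultimately have "steiner_triple_system (3 * N) ?W (S1 \<union> S2)"
    by (intro steiner_triple_system_if_covering[OF W]) (auto simp: card_cartesian_product)
  then show ?thesis by blast
qed

text \<open>The point \<open>(N, 0)\<close> plays the role of the point at infinity in Skolem's construction.\<close>

lemma skolem_construction:
  fixes f :: "nat \<Rightarrow> nat \<Rightarrow> nat"
  assumes N: "N = 2 * t"
    and comm: "\<And>x y. f x y = f y x" and cl: "\<And>x y. x < N \<Longrightarrow> y < N \<Longrightarrow> f x y < N"
    and div: "\<And>x z. x < N \<Longrightarrow> z < N \<Longrightarrow> \<exists>y<N. f x y = z"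
    and idem: "\<And>x. x < N \<Longrightarrow> f x x = (if x < t then x else x - t)"
  shows "\<exists>S. steiner_triple_system (3 * N + 1) (insert (N, 0) ({0..<N} \<times> {0..<3::nat})) S"
proof -
  let ?W = "insert (N, 0) ({0..<N} \<times> {0..<3::nat})"
  define S1 where "S1 = (\<lambda>x. {(x, 0), (x, 1), (x, 2::nat)}) ` {0..<t}"
  define S2 where "S2 = {{(x, i), (y, i), (f x y, Suc i mod 3)} | x y i. x < N \<and> y < N \<and> x \<noteq> y \<and> i < (3::nat)}"
  \<comment> \<open>For \<open>x < t\<close> the diagonal of \<open>f\<close> sends both
    \<open>x\<close> and \<open>x + t\<close> to \<open>x\<close>, so vertical triples settle only
    the lower half. The pair (x + t, i), (x, i + 1) that this leaves uncovered is completed by the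
    point at infinity.\<close>
  define S3 where "S3 = (\<lambda>(x, i). {(N, 0), (x + t, i), (x, Suc i mod 3)}) ` ({0..<t} \<times> {0..<3::nat})"
  have i3: "i \<noteq> Suc i mod 3" if "i < 3" for i :: nat using that by (auto simp: mod_Suc)
  have W: "three_graph ?W (S1 \<union> S2 \<union> S3)" unfolding three_graph_def
  proof (intro conjI subsetI)
    fix E assume "E \<in> S1 \<union> S2 \<union> S3"
    then consider "E \<in> S1" | "E \<in> S2" | "E \<in> S3" by blast
    then show "E \<in> {E. E \<subseteq> ?W \<and> card E = 3}"
    proof cases
      case 1 then show ?thesis using N by (auto simp: S1_def)
    next
      case 2
      then obtain x y i where "E = {(x, i), (y, i), (f x y, Suc i mod 3)}" "x < N" "y < N" "x \<noteq> y" "i < 3"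
        unfolding S2_def by blast
      then show ?thesis using cl i3[of i] by simp
    next
      case 3
      then obtain x i where "E = {(N, 0), (x + t, i), (x, Suc i mod 3)}" "x < t" "i < 3"
        unfolding S3_def by auto
      then show ?thesis using N i3[of i] by auto
    qed
  qed simp
  have S3: "{(N, 0), (x + t, i), (x, Suc i mod 3)} \<in> S3" if "x < t" "i < 3" for x i
    using that unfolding S3_def by force
  have up: "\<exists>E\<in>S1 \<union> S2 \<union> S3. {(x, i), (z, Suc i mod 3)} \<subseteq> E" if x: "x < N" "z < N" "i < 3" for x z i
  proof -
    obtain y where y: "y < N" "f x y = z" using div x by blast
    consider "x \<noteq> y" | "x = y" "x < t" | "x = y" "\<not> x < t" by blast
    then show ?thesis
    proof cases
      case 1
      then have "{(x, i), (y, i), (f x y, Suc i mod 3)} \<in> S2" using x y unfolding S2_def by blast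
      then show ?thesis using y by (intro bexI[of _ "{(x, i), (y, i), (f x y, Suc i mod 3)}"]) auto
    next
      case 2
      then have "z = x" using idem y by simp
      then have "{(x, i), (z, Suc i mod 3)} \<subseteq> {(x, 0), (x, 1), (x, 2)}"
        using x(3) by (auto simp: mod_Suc)
      then show ?thesis using 2 by (intro bexI[of _ "{(x, 0), (x, 1), (x, 2)}"]) (auto simp: S1_def)
    next
      case 3
      then have "x = z + t" "z < t" using idem y N by auto
      then show ?thesis using S3[of z i] x by (intro bexI[of _ "{(N, 0), (z + t, i), (z, Suc i mod 3)}"]) auto
    qed
  qed
  have inf: "\<exists>E\<in>S1 \<union> S2 \<union> S3. {(N, 0), (x, i)} \<subseteq> E" if x: "x < N" "i < 3" for x i
  proof (cases "x < t")
    case True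
    define j where "j = (if i = 0 then 2 else i - 1)"
    have "j < 3" "Suc j mod 3 = i" using x(2) by (auto simp: j_def)
    then show ?thesis using S3[OF True, of j] by (intro bexI[of _ "{(N, 0), (x + t, j), (x, Suc j mod 3)}"]) auto
  next
    case False
    then have "x - t < t" "x - t + t = x" using x N by auto
    then show ?thesis using S3[of "x - t" i] x
      by (intro bexI[of _ "{(N, 0), (x - t + t, i), (x - t, Suc i mod 3)}"]) auto
  qed
  have fin: "\<exists>E\<in>S1 \<union> S2 \<union> S3. {(x, i), (z, j)} \<subseteq> E"
    if q: "x < N" "i < 3" "z < N" "j < 3" "(x, i) \<noteq> (z, j)" for x i z j
  proof -
    consider "i = j" | "j = Suc i mod 3" | "i = Suc j mod 3"
      using level_cases[OF q(2,4)] by blast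
    then show ?thesis
    proof cases
      case 1
      then have "{(x, i), (z, i), (f x z, Suc i mod 3)} \<in> S2" using q unfolding S2_def by blast
      then show ?thesis using q 1 by (intro bexI[of _ "{(x, i), (z, i), (f x z, Suc i mod 3)}"]) auto
    next
      case 2 then show ?thesis using up[of x z i] q by simp
    next
      case 3 then show ?thesis using up[of z x j] q by (simp add: insert_commute)
    qed
  qed
  have "\<exists>E\<in>S1 \<union> S2 \<union> S3. {p, p'} \<subseteq> E" if p: "p \<in> ?W" "p' \<in> ?W" "p \<noteq> p'" for p p'
  proof (cases "p = (N, 0) \<or> p' = (N, 0)")
    case True
    then show ?thesis
    proof
      assume 1: "p = (N, 0)"
      then obtain x i where "p' = (x, i)" "x < N" "i < 3" using p(2,3) by auto
      then show ?thesis using inf[of x i] 1 by simp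
    next
      assume 1: "p' = (N, 0)"
      then obtain x i where "p = (x, i)" "x < N" "i < 3" using p(1,3) by auto
      then show ?thesis using inf[of x i] 1 by (simp add: insert_commute)
    qed
  next
    case False
    have pp: "p \<in> {0..<N} \<times> {0..<3}" "p' \<in> {0..<N} \<times> {0..<3}" using False p(1,2) by blast+
    obtain x i where "p = (x, i)" "x < N" "i < 3" using pp(1) by auto
    moreover obtain z j where "p' = (z, j)" "z < N" "j < 3" using pp(2) by auto
    ultimately show ?thesis using fin[of x i z j] p by simp
  qed
  moreover have "6 * card (S1 \<union> S2 \<union> S3) \<le> (3 * N + 1) * (3 * N + 1 - 1)"
  proof -
    have "card (S1 \<union> S2 \<union> S3) \<le> card S1 + card S2 + card S3"
      using card_Un_le[of "S1 \<union> S2" S3] card_Un_le[of S1 S2] by simp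
    also have "card S1 \<le> t" unfolding S1_def using card_image_le[of "{0..<t}"] by simp
    also have "card S2 \<le> 3 * (N * (N - 1) div 2)" unfolding S2_def by (rule card_mixed_triples[OF comm])
    also have "card S3 \<le> card ({0..<t} \<times> {0..<3::nat})" unfolding S3_def by (rule card_image_le) simp
    also have "N * (N - 1) div 2 = t * (2 * t - 1)" unfolding N by simp
    finally have *: "card (S1 \<union> S2 \<union> S3) \<le> 4 * t + 3 * (t * (2 * t - 1))"
      by (simp add: card_cartesian_product)
    show ?thesis
    \<comment> \<open>The case \<open>t = 0\<close>, the one-point system, is separated because of
      the truncated \<open>2 * t - 1\<close>.\<close>
    proof (cases t)
      case 0 then show ?thesis using * by simp
    next
      case (Suc s) then show ?thesis using * N by (simp add: algebra_simps)
    qed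
  qed
  moreover have "card ?W = 3 * N + 1" by (subst card_insert_disjoint) (auto simp: card_cartesian_product)
  ultimately have "steiner_triple_system (3 * N + 1) ?W (S1 \<union> S2 \<union> S3)"
    by (intro steiner_triple_system_if_covering[OF W]) auto
  then show ?thesis by blast
qed

theorem kirkman:
  assumes "k mod 6 = 1 \<or> k mod 6 = 3"
  shows "\<exists>(W :: (nat \<times> nat) set) S. steiner_triple_system k W S"
  using assms
proof
  assume k: "k mod 6 = 3"
  define t where "t = k div 6"
  define N where "N = 2 * t + 1"
  have kN: "k = 3 * N" using k mult_div_mod_eq[of 6 k] by (simp add: N_def t_def)
  \<comment> \<open>\<open>t + 1\<close> is the inverse of 2 modulo \<open>2 * t + 1\<close>, so
    \<open>f\<close> is the midpoint. The solution of \<open>f x y = z\<close> is 2 z - x, where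
    \<open>N - x\<close> stands for -x.\<close>
  define f where "f x y = ((t + 1) * (x + y)) mod N" for x y
  have half: "((t + 1) * (2 * z)) mod N = z" if "z < N" for z
  proof -
    have "(t + 1) * (2 * z) = z + N * z" by (simp add: N_def algebra_simps)
    then show ?thesis using that by (simp only: mod_mult_self2 mod_less)
  qed
  have "\<exists>y<N. f x y = z" if "x < N" "z < N" for x z
  proof (intro exI conjI)
    show "(2 * z + (N - x)) mod N < N" by (simp add: N_def)
    have "f x ((2 * z + (N - x)) mod N) = ((t + 1) * (x + (2 * z + (N - x)))) mod N"
      unfolding f_def by (metis mod_add_right_eq mod_mult_right_eq)
    also have "x + (2 * z + (N - x)) = 2 * z + N" using that by simp
    also have "((t + 1) * (2 * z + N)) mod N = ((t + 1) * (2 * z)) mod N"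
      by (metis mod_add_self2 mod_mult_right_eq)
    finally show "f x ((2 * z + (N - x)) mod N) = z" using half[OF that(2)] by simp
  qed
  moreover have "f x x = x" if "x < N" for x using half[OF that] by (simp add: f_def mult_2)
  moreover have "f x y < N" for x y by (simp add: f_def N_def)
  moreover have "f x y = f y x" for x y by (simp add: f_def add.commute)
  moreover have "odd N" by (simp add: N_def)
  ultimately show ?thesis using bose_construction[of f N] kN by blast
next
  assume k: "k mod 6 = 1"
  define t where "t = k div 6"
  define N where "N = 2 * t"
  have kN: "k = 3 * N + 1" using k mult_div_mod_eq[of 6 k] by (simp add: N_def t_def)
  \<comment> \<open>Relabels the addition table modulo \<open>N\<close>: even values go to the lower
    half, odd values to the upper half. Since \<open>N\<close> is even, 2 x modulo \<open>N\<close>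
    is even, so the diagonal of \<open>f\<close> takes values in the lower half only, as Skolem's
    construction wants.\<close>
  define h where "h s = (if even s then s div 2 else t + s div 2)" for s
  define f where "f x y = h ((x + y) mod N)" for x y
  have "f x y < N" if "x < N" "y < N" for x y
  proof -
    have "(x + y) mod N < N" using that by simp
    then show ?thesis unfolding f_def h_def N_def by auto
  qed
  moreover have "\<exists>y<N. f x y = z" if "x < N" "z < N" for x z
  proof (intro exI conjI)
    define s where "s = (if z < t then 2 * z else 2 * (z - t) + 1)"
    have s: "s < N" "h s = z" using that by (auto simp: s_def h_def N_def)
    show "(s + (N - x)) mod N < N" using that by simp
    have "(x + (s + (N - x)) mod N) mod N = (x + (s + (N - x))) mod N" by (rule mod_add_right_eq)
    also have "x + (s + (N - x)) = s + N" using that by simp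
    finally show "f x ((s + (N - x)) mod N) = z" using s by (simp add: f_def)
  qed
  moreover have "f x x = (if x < t then x else x - t)" if "x < N" for x
  proof (cases "x < t")
    case True
    then have "(x + x) mod N = 2 * x" by (simp add: N_def)
    then show ?thesis using True by (simp add: f_def h_def)
  next
    case False
    then have "x + x = 2 * (x - t) + N" "2 * (x - t) < N" using that by (auto simp: N_def)
    then have "(x + x) mod N = 2 * (x - t)" by simp
    then show ?thesis using False by (simp add: f_def h_def)
  qed
  moreover have "f x y = f y x" for x y by (simp add: f_def add.commute)
  ultimately show ?thesis using skolem_construction[OF N_def, of f] kN by blast
qed

section \<open>The size of the Turan graph\<close>

text \<open>Of the n^2 ordered pairs, those inside a common part, the diagonal included, contribute
  the squares of the part sizes; the others count each Turan edge twice.\<close>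

lemma t2_eq:
  assumes k: "k > 0"
  shows "2 * t2 n k + (k - n mod k) * (n div k) ^ 2 + (n mod k) * (n div k + 1) ^ 2 = n ^ 2"
proof -
  have sym: "{i, j} \<in> turan_edges n k \<longleftrightarrow> i < n \<and> j < n \<and> i mod k \<noteq> j mod k" for i j
    unfolding turan_edges_def turan_part_def using k by (auto simp: doubleton_eq_iff)
  have te: "\<And>e. e \<in> turan_edges n k \<Longrightarrow> card e = 2 \<and> e \<subseteq> {..<n}"
    by (auto simp: turan_edges_def turan_part_def card_2_iff)
  then have "turan_edges n k \<subseteq> Pow {..<n}" by blast
  then have fin: "finite (turan_edges n k)" by (rule finite_subset) simp
  have "2 * t2 n k = card {(i, j). {i, j} \<in> turan_edges n k}"
    unfolding t2_def using card_ordered_pairs[OF fin] te by simp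
  moreover have "{(i, j). {i, j} \<in> turan_edges n k} = {..<n} \<times> {..<n} - (\<Union>r\<in>{..<k}. turan_part n k r \<times> turan_part n k r)"
    using k by (auto simp: sym turan_part_def)
  moreover have sub: "(\<Union>r\<in>{..<k}. turan_part n k r \<times> turan_part n k r) \<subseteq> {..<n} \<times> {..<n}"
    by (auto simp: turan_part_def)
  moreover have "finite (\<Union>r\<in>{..<k}. turan_part n k r \<times> turan_part n k r)"
    by (rule finite_subset[OF sub]) simp
  ultimately have 1: "2 * t2 n k + card (\<Union>r\<in>{..<k}. turan_part n k r \<times> turan_part n k r) = n ^ 2"
    using card_mono[OF _ sub] by (simp add: card_Diff_subset power2_eq_square card_cartesian_product)
  have "card (\<Union>r\<in>{..<k}. turan_part n k r \<times> turan_part n k r)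
      = (\<Sum>r<k. card (turan_part n k r \<times> turan_part n k r))"
    by (rule card_UN_disjoint) (auto simp: turan_part_def)
  also have "\<dots> = (\<Sum>r<k. if r < n mod k then (n div k + 1) ^ 2 else (n div k) ^ 2)"
    by (rule sum.cong) (auto simp: card_cartesian_product card_turan_part power2_eq_square)
  also have "\<dots> = (n mod k) * (n div k + 1) ^ 2 + (k - n mod k) * (n div k) ^ 2"
  proof -
    have "n mod k < k" using k by simp
    then have "{..<k} \<inter> {r. r < n mod k} = {..<n mod k}" "{..<k} \<inter> - {r. r < n mod k} = {n mod k..<k}" by auto
    then show ?thesis by (subst sum.If_cases) simp_all
  qed
  finally show ?thesis using 1 by simp
qed

section \<open>Codegrees in cancellative 3-graphs\<close>

locale cancellative_3graph =
  fixes V :: "'a set" and H :: "'a set set"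
  assumes three_graph: "three_graph V H" and cancellative: "cancellative H"
begin

definition co :: "'a \<Rightarrow> 'a \<Rightarrow> 'a set" where
  "co u v = {w. {u, v, w} \<in> H}"

definition adj :: "'a \<Rightarrow> 'a \<Rightarrow> bool" where
  "adj u v \<longleftrightarrow> co u v \<noteq> {}"

text \<open>Contains \<open>v\<close> itself, so in a complete multipartite shadow it is the whole
  part of \<open>v\<close>.\<close>

definition nonadj :: "'a \<Rightarrow> 'a set" where
  "nonadj v = {w \<in> V. \<not> adj v w}"

definition adj_pairs :: "('a \<times> 'a) set" where
  "adj_pairs = {(u, v). adj u v}"

lemma finite_V [simp]: "finite V"
  using three_graph by (simp add: three_graph_def)

lemma edgeD: "E \<in> H \<Longrightarrow> E \<subseteq> V \<and> card E = 3"
  using three_graph by (auto simp: three_graph_def)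

lemma finite_H [simp]: "finite H"
proof -
  have "H \<subseteq> Pow V" using edgeD by blast
  then show ?thesis by (rule finite_subset) simp
qed

lemma coD:
  assumes "w \<in> co u v"
  shows "u \<in> V" "v \<in> V" "w \<in> V" "u \<noteq> v" "u \<noteq> w" "v \<noteq> w"
proof -
  have E: "{u, v, w} \<subseteq> V" "card {u, v, w} = 3" using assms edgeD by (auto simp: co_def)
  then show "u \<in> V" "v \<in> V" "w \<in> V" by auto
  show "u \<noteq> v" "u \<noteq> w" "v \<noteq> w" using E(2) by (auto simp: card_insert_if split: if_splits)
qed

lemma co_commute: "co u v = co v u"
  by (simp add: co_def insert_commute)

lemma co_rotate: "w \<in> co u v \<longleftrightarrow> v \<in> co u w"
  by (simp add: co_def insert_commute)

lemma co_subset_V: "co u v \<subseteq> V"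
  using coD(3) by blast

lemma finite_co [simp]: "finite (co u v)"
  using co_subset_V by (rule finite_subset) simp

lemma adj_commute: "adj u v \<longleftrightarrow> adj v u"
  by (simp add: adj_def co_commute)

lemma adjI: "w \<in> co u v \<Longrightarrow> adj u v"
  by (auto simp: adj_def)

lemma adjD: "adj u v \<Longrightarrow> u \<in> V \<and> v \<in> V \<and> u \<noteq> v"
  unfolding adj_def using coD by blast

lemma not_adj_self: "\<not> adj v v"
  using adjD by blast

lemma co_subset_adj: "w \<in> co u v \<Longrightarrow> adj u w \<and> adj v w"
  using adjI co_rotate co_commute by metis

text \<open>Two edges through the pair u, v differ exactly in w and w', so an edge through w and w'
  would be the forbidden third one. This is the only direct appeal to cancellativity.\<close>

lemma co_independent:
  assumes w: "w \<in> co u v" "w' \<in> co u v"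
  shows "\<not> adj w w'"
proof
  assume "adj w w'"
  then obtain x where "x \<in> co w w'" by (auto simp: adj_def)
  note ww = coD[OF this] and x = this
  note a = coD[OF w(1)] and b = coD[OF w(2)]
  have "{u, v, w} \<in> H" "{u, v, w'} \<in> H" "{w, w', x} \<in> H" using w x by (auto simp: co_def)
  moreover have "w \<notin> {u, v, w'}" using a ww(4) by auto
  then have "{u, v, w} \<noteq> {u, v, w'}" by (metis insertCI)
  moreover have "w' \<notin> {u, v, w}" using b ww(4) by auto
  then have "{u, v, w} \<noteq> {w, w', x}" by (metis insertCI)
  moreover have "{u, v, w'} \<noteq> {w, w', x}" using \<open>w \<notin> {u, v, w'}\<close> by (metis insertCI)
  moreover have "({u, v, w} - {u, v, w'}) \<union> ({u, v, w'} - {u, v, w}) \<subseteq> {w, w', x}" by auto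
  ultimately show False using cancellative unfolding cancellative_def by metis
qed

lemma co_subset_nonadj: "w \<in> co u v \<Longrightarrow> co u v \<subseteq> nonadj w"
  using co_independent[of w u v] coD(3) unfolding nonadj_def by blast

lemma nonadj_subset_V: "nonadj v \<subseteq> V"
  by (auto simp: nonadj_def)

lemma finite_nonadj [simp]: "finite (nonadj v)"
  using nonadj_subset_V by (rule finite_subset) simp

lemma card_co_le_nonadj: "w \<in> co u v \<Longrightarrow> card (co u v) \<le> card (nonadj w)"
  using co_subset_nonadj by (intro card_mono) simp_all

lemma card_adj: "v \<in> V \<Longrightarrow> card {w. adj v w} + card (nonadj v) = card V"
proof -
  have "{w. adj v w} = V - nonadj v" using adjD by (auto simp: nonadj_def)
  then show ?thesis using card_mono[OF finite_V nonadj_subset_V, of v]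
    by (simp add: card_Diff_subset nonadj_subset_V)
qed

lemma adj_pairs_eq: "adj_pairs = (SIGMA v:V. {w. adj v w})"
  using adjD by (auto simp: adj_pairs_def)

lemma adj_pairs_subset: "adj_pairs \<subseteq> offdiag V"
  using adjD by (auto simp: adj_pairs_def offdiag_def)

lemma finite_adj_pairs [simp]: "finite adj_pairs"
  using adj_pairs_subset by (rule finite_subset) simp

lemma finite_adj [simp]: "finite {w. adj v w}"
  by (rule finite_subset[of _ V]) (use adjD in auto)

lemma in_shadow: "{u, v} \<in> shadow H \<longleftrightarrow> adj u v"
proof
  assume "{u, v} \<in> shadow H"
  then obtain B where B: "B \<in> H" "{u, v} \<subseteq> B" "card {u, v} = 2" by (auto simp: shadow_def)
  then have c: "card B = 3" using edgeD by blast
  then have "finite B" by (metis card.infinite zero_neq_numeral)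
  then have "card (B - {u, v}) = 1" using c B by (simp add: card_Diff_subset)
  then obtain w where w: "B - {u, v} = {w}" by (rule card_1_singletonE)
  then have "{u, v, w} = B" using B(2) by blast
  then have "w \<in> co u v" using B(1) by (simp add: co_def)
  then show "adj u v" by (rule adjI)
next
  assume "adj u v"
  then obtain w where w: "w \<in> co u v" by (auto simp: adj_def)
  note d = coD[OF w]
  have "{u, v, w} \<in> H" using w by (simp add: co_def)
  moreover have "{u, v} \<subset> {u, v, w}" using d by auto
  moreover have "card {u, v} = 2" using d by simp
  ultimately show "{u, v} \<in> shadow H" unfolding shadow_def by blast
qed

lemma card_adj_pairs: "card adj_pairs = 2 * card (shadow H)"
proof -
  have "shadow H \<subseteq> Pow V" using edgeD by (auto simp: shadow_def)
  then have "finite (shadow H)" by (rule finite_subset) simp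
  then have "card {(u, v). {u, v} \<in> shadow H} = 2 * card (shadow H)"
    by (rule card_ordered_pairs) (simp add: shadow_def)
  then show ?thesis by (simp add: in_shadow adj_pairs_def)
qed

lemma sum_card_co: "(\<Sum>(u, v)\<in>adj_pairs. card (co u v)) = 6 * card H"
proof -
  have "card {E \<in> H. (u, v) \<in> offdiag E} = card (co u v)" if uv: "u \<noteq> v" for u v
  proof (rule bij_betw_same_card[symmetric])
    show "bij_betw (\<lambda>w. {u, v, w}) (co u v) {E \<in> H. (u, v) \<in> offdiag E}"
    proof (rule bij_betw_imageI)
      show "inj_on (\<lambda>w. {u, v, w}) (co u v)"
      proof (rule inj_onI)
        fix w w' assume "w \<in> co u v" "w' \<in> co u v" and eq: "{u, v, w} = {u, v, w'}"
        then have "w \<noteq> u" "w \<noteq> v" using coD by blast+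
        moreover have "w \<in> {u, v, w'}" unfolding eq [symmetric] by simp
        ultimately show "w = w'" by simp
      qed
      show "(\<lambda>w. {u, v, w}) ` co u v = {E \<in> H. (u, v) \<in> offdiag E}"
      proof (intro equalityI subsetI)
        fix E assume "E \<in> (\<lambda>w. {u, v, w}) ` co u v"
        then show "E \<in> {E \<in> H. (u, v) \<in> offdiag E}" using uv by (auto simp: co_def offdiag_def)
      next
        fix E assume "E \<in> {E \<in> H. (u, v) \<in> offdiag E}"
        then have E: "E \<in> H" "{u, v} \<subseteq> E" by (auto simp: offdiag_def)
        then have c: "card E = 3" using edgeD by blast
        then have "finite E" by (metis card.infinite zero_neq_numeral)
        then have "card (E - {u, v}) = 1" using c E uv by (simp add: card_Diff_subset)
        then obtain w where "E - {u, v} = {w}" by (rule card_1_singletonE)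
        then have "{u, v, w} = E" using E(2) by blast
        then show "E \<in> (\<lambda>w. {u, v, w}) ` co u v" using E(1) by (auto simp: co_def)
      qed
    qed
  qed
  then have "(\<Sum>(u, v)\<in>offdiag V. card (co u v)) = (\<Sum>p\<in>offdiag V. card {E \<in> H. p \<in> offdiag E})"
    by (intro sum.cong) (auto simp: offdiag_def)
  also have "\<dots> = 6 * card H" by (rule sum_card_containing_pair[OF three_graph])
  finally have "(\<Sum>(u, v)\<in>offdiag V. card (co u v)) = 6 * card H" .
  moreover have "(\<Sum>(u, v)\<in>adj_pairs. card (co u v)) = (\<Sum>(u, v)\<in>offdiag V. card (co u v))"
    using adj_pairs_subset by (intro sum.mono_neutral_left) (auto simp: adj_pairs_def adj_def)
  ultimately show ?thesis by simp
qed

lemma card_co_pos: "(u, v) \<in> adj_pairs \<Longrightarrow> card (co u v) > 0"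
  by (simp add: adj_pairs_def adj_def card_gt_0_iff)

lemma card_nonadj_pos: "v \<in> V \<Longrightarrow> card (nonadj v) > 0"
  using not_adj_self by (auto simp: nonadj_def card_gt_0_iff)

text \<open>For an edge \<open>{u, v, w}\<close> the set \<open>co u v\<close> is independent and contains \<open>w\<close>, so its size is at
  most that of \<open>nonadj w\<close>. Summing \<open>|nonadj v| / |co u v| + |nonadj w| / |co u w| \<ge> 2\<close> over all
  edges gives \<open>6 |H| \<le> \<Sum> |nonadj v|\<close>, and the left-hand side below records what is lost.\<close>

lemma codegree_defect:
  "(\<Sum>(u, v)\<in>adj_pairs. (real (card (nonadj v)) - real (card (co u v)))\<^sup>2 / real (card (nonadj v)))
    \<le> 2 * (\<Sum>(u, v)\<in>adj_pairs. real (card (nonadj v))) - 12 * real (card H)"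
proof -
  define a where "a v = real (card (nonadj v))" for v
  define d where "d u v = real (card (co u v))" for u v
  define T where "T = (SIGMA p:adj_pairs. co (fst p) (snd p))"
  have dpos: "d u v > 0" if "w \<in> co u v" for u v w
    using card_co_pos adjI[OF that] by (simp add: adj_pairs_def d_def)
  have sumT: "(\<Sum>((u, v), w)\<in>T. f u v) = (\<Sum>(u, v)\<in>adj_pairs. d u v * f u v)" for f :: "'a \<Rightarrow> 'a \<Rightarrow> real"
  proof -
    have "(\<Sum>((u, v), w)\<in>T. f u v) = (\<Sum>p\<in>adj_pairs. \<Sum>w\<in>co (fst p) (snd p). f (fst p) (snd p))"
      unfolding T_def by (subst sum.Sigma) (auto simp: case_prod_unfold)
    then show ?thesis by (simp add: case_prod_unfold d_def)
  qed
  \<comment> \<open>An edge occurs in \<open>T\<close> once for each of its six orderings, and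
    exchanging v and w permutes \<open>T\<close>.\<close>
  have swap: "(\<Sum>((u, v), w)\<in>T. f u w) = (\<Sum>((u, v), w)\<in>T. f u v)" for f :: "'a \<Rightarrow> 'a \<Rightarrow> real"
    by (rule sum.reindex_bij_witness[of _ "\<lambda>((u, v), w). ((u, w), v)" "\<lambda>((u, v), w). ((u, w), v)"])
      (auto simp: T_def adj_pairs_def intro: co_rotate[THEN iffD1] dest: co_subset_adj)
  \<comment> \<open>The bounds are used crosswise: \<open>d u v \<le> a w\<close> and
    \<open>d u w \<le> a v\<close> give \<open>d u v / a v \<le> a w / d u w\<close>. What remains
    has the form x + 1/x - 2, which times \<open>d u v\<close> is the squared defect divided by
    \<open>a v\<close>.\<close>
  have le: "a v / d u v + d u v / a v - 2 \<le> a v / d u v + a w / d u w - 2" if "w \<in> co u v" for u v w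
  proof -
    have v: "v \<in> co u w" using that co_rotate by blast
    have "d u v \<le> a w" "d u w \<le> a v" using card_co_le_nonadj that v by (auto simp: a_def d_def)
    then have "d u v / a v \<le> a w / d u w" using dpos[OF v] dpos[OF that] by (intro frac_le) auto
    then show ?thesis by simp
  qed
  have "(\<Sum>(u, v)\<in>adj_pairs. (a v - d u v)\<^sup>2 / a v) = (\<Sum>(u, v)\<in>adj_pairs. d u v * (a v / d u v + d u v / a v - 2))"
  proof (rule sum.cong[OF refl], clarify)
    fix u v assume uv: "(u, v) \<in> adj_pairs"
    then have "v \<in> V" using adjD by (auto simp: adj_pairs_def)
    then have "a v > 0" "d u v > 0" using card_co_pos[OF uv] card_nonadj_pos by (auto simp: a_def d_def)
    then show "(a v - d u v)\<^sup>2 / a v = d u v * (a v / d u v + d u v / a v - 2)"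
      by (simp add: field_simps power2_eq_square)
  qed
  also have "\<dots> = (\<Sum>((u, v), w)\<in>T. a v / d u v + d u v / a v - 2)"
    by (rule sumT[symmetric])
  also have "\<dots> \<le> (\<Sum>((u, v), w)\<in>T. a v / d u v + a w / d u w - 2)"
    by (rule sum_mono) (use le in \<open>auto simp: T_def\<close>)
  also have "\<dots> = (\<Sum>((u, v), w)\<in>T. a v / d u v) + (\<Sum>((u, v), w)\<in>T. a w / d u w) - (\<Sum>((u, v), w)\<in>T. 2)"
    by (simp add: case_prod_unfold sum.distrib sum_subtractf)
  also have "(\<Sum>((u, v), w)\<in>T. a w / d u w) = (\<Sum>((u, v), w)\<in>T. a v / d u v)"
    by (rule swap)
  also have "(\<Sum>((u, v), w)\<in>T. a v / d u v) = (\<Sum>(u, v)\<in>adj_pairs. d u v * (a v / d u v))"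
    by (rule sumT)
  also have "\<dots> = (\<Sum>(u, v)\<in>adj_pairs. a v)"
    by (rule sum.cong[OF refl]) (use card_co_pos in \<open>force simp: d_def\<close>)
  also have "(\<Sum>((u, v), w)\<in>T. 2) = (\<Sum>(u, v)\<in>adj_pairs. d u v * 2)"
    by (rule sumT)
  also have "\<dots> = 2 * real (\<Sum>(u, v)\<in>adj_pairs. card (co u v))"
    by (simp add: d_def case_prod_unfold sum_distrib_left mult.commute)
  also have "\<dots> = 12 * real (card H)" unfolding sum_card_co by simp
  finally show ?thesis unfolding a_def d_def by simp
qed

text \<open>\<open>D\<close> is the average degree of the shadow. For a degree x, the identity x (N
  - x) = (N - 2 D) x + D^2 - (x - D)^2 makes convexity quantitative: the linear term has a known
  sum, and the variance remains as a second defect. The halving occurs because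
  \<open>codegree_defect\<close> is an estimate of twelve times \<open>card H\<close>.\<close>

lemma stability:
  assumes n: "card V > 0" and m: "m = real (card (shadow H))" and D: "D = 2 * m / card V"
  shows "(\<Sum>v\<in>V. (real (card V) - real (card (nonadj v)) - D)\<^sup>2) +
    (\<Sum>(u, v)\<in>adj_pairs. (real (card (nonadj v)) - real (card (co u v)))\<^sup>2 / real (card (nonadj v))) / 2
    \<le> 2 * m * card V - 4 * m\<^sup>2 / card V - 6 * card H"
proof -
  define a where "a v = real (card (nonadj v))" for v
  define N where "N = real (card V)"
  have N: "N > 0" using n by (simp add: N_def)
  have deg: "real (card {w. adj v w}) = N - a v" if "v \<in> V" for v
    using card_adj[OF that] by (simp add: N_def a_def flip: of_nat_add)
  have sumP: "(\<Sum>(u, v)\<in>adj_pairs. f v) = (\<Sum>v\<in>V. (N - a v) * f v)" for f :: "'a \<Rightarrow> real"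
  proof -
    have "(\<Sum>(u, v)\<in>adj_pairs. f v) = (\<Sum>(v, u)\<in>adj_pairs. f v)"
      by (rule sum.reindex_bij_witness[of _ prod.swap prod.swap])
        (auto simp: adj_pairs_def adj_commute)
    also have "\<dots> = (\<Sum>v\<in>V. \<Sum>u\<in>{w. adj v w}. f v)"
      unfolding adj_pairs_eq by (subst sum.Sigma) (auto simp: case_prod_unfold)
    also have "\<dots> = (\<Sum>v\<in>V. (N - a v) * f v)"
      by (rule sum.cong[OF refl]) (simp add: deg)
    finally show ?thesis .
  qed
  have "(\<Sum>v\<in>V. N - a v) = (\<Sum>(u, v)\<in>adj_pairs. 1)"
    using sumP[of "\<lambda>_. 1"] by simp
  also have "\<dots> = real (card adj_pairs)" by (simp add: case_prod_unfold)
  also have "\<dots> = 2 * m" unfolding card_adj_pairs m by simp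
  finally have s1: "(\<Sum>v\<in>V. N - a v) = 2 * m" .
  have "(N - a v) * a v = (N - 2 * D) * (N - a v) + D\<^sup>2 - (N - a v - D)\<^sup>2" for v
    by (simp add: algebra_simps power2_eq_square)
  then have "(\<Sum>v\<in>V. (N - a v) * a v) = (\<Sum>v\<in>V. (N - 2 * D) * (N - a v) + D\<^sup>2 - (N - a v - D)\<^sup>2)"
    by (rule sum.cong[OF refl])
  also have "\<dots> = (\<Sum>v\<in>V. (N - 2 * D) * (N - a v)) + (\<Sum>v\<in>V. D\<^sup>2) - (\<Sum>v\<in>V. (N - a v - D)\<^sup>2)"
    by (simp only: sum.distrib sum_subtractf[of "\<lambda>v. (N - 2 * D) * (N - a v) + D\<^sup>2"])
  also have "\<dots> = (N - 2 * D) * (\<Sum>v\<in>V. N - a v) + N * D\<^sup>2 - (\<Sum>v\<in>V. (N - a v - D)\<^sup>2)"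
    by (simp only: sum_distrib_left [symmetric] sum_constant N_def)
  also have "(N - 2 * D) * (\<Sum>v\<in>V. N - a v) + N * D\<^sup>2 = 2 * m * N - 4 * m\<^sup>2 / N"
    using N unfolding s1 D N_def[symmetric] by (simp add: field_simps power2_eq_square)
  finally have "(\<Sum>(u, v)\<in>adj_pairs. a v) = 2 * m * N - 4 * m\<^sup>2 / N - (\<Sum>v\<in>V. (N - a v - D)\<^sup>2)"
    using sumP[of a] by simp
  then show ?thesis using codegree_defect unfolding a_def N_def by simp
qed

end

section \<open>Structure of near-extremal 3-graphs\<close>

text \<open>The slack obtained from near-extremality is linear in \<open>card V\<close>, while a pair of codegree below
  \<open>X - 2 * e\<close> costs a linear amount. Hence the number of such pairs is bounded by a constant.\<close>

locale near_extremal = cancellative_3graph +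
  fixes k :: nat and X e :: real
  assumes k3: "k \<ge> 3" and card_V: "real (card V) = k * X" and e_pos: "e > 0" and X_ge: "X \<ge> 100 * real k * e"
    and nonadj_close: "v \<in> V \<Longrightarrow> \<bar>real (card (nonadj v)) - X\<bar> \<le> e"
    and few_bad: "(real (card {(u, v) \<in> adj_pairs. real (card (co u v)) < X - 2 * e}))\<^sup>2 \<le> e"
begin

definition bad :: "('a \<times> 'a) set" where
  "bad = {(u, v) \<in> adj_pairs. real (card (co u v)) < X - 2 * e}"

definition good :: "'a \<Rightarrow> 'a \<Rightarrow> bool" where
  "good u v \<longleftrightarrow> X - 2 * e \<le> real (card (co u v))"

text \<open>Independent sets of the shadow that nearly fill a part. Independence is phrased with
  \<open>nonadj\<close> so that the bound \<open>X + e\<close> on its size applies at once.\<close>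

definition big :: "'a set \<Rightarrow> bool" where
  "big J \<longleftrightarrow> (\<forall>z\<in>J. J \<subseteq> nonadj z) \<and> X - 2 * e \<le> real (card J)"

lemma X_ge_300: "X \<ge> 300 * e"
proof -
  have "300 * e \<le> (100 * real k) * e" using k3 e_pos by (intro mult_right_mono) auto
  then show ?thesis using X_ge by linarith
qed

lemma finite_bad [simp]: "finite bad"
  unfolding bad_def by (rule finite_subset[OF _ finite_adj_pairs]) auto

lemma card_bad_sq: "(real (card bad))\<^sup>2 \<le> e"
  using few_bad by (simp add: bad_def)

lemma card_bad: "real (card bad) \<le> e"
proof (cases "card bad = 0")
  case True then show ?thesis using e_pos by simp
next
  case False
  then have "1 \<le> real (card bad)" by linarith
  then have "real (card bad) * 1 \<le> real (card bad) * real (card bad)" by (intro mult_left_mono) simp_all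
  then show ?thesis using card_bad_sq by (simp add: power2_eq_square)
qed

lemma not_good_bad: "adj u v \<Longrightarrow> \<not> good u v \<Longrightarrow> (u, v) \<in> bad"
  by (auto simp: bad_def good_def adj_pairs_def)

lemma good_commute: "good u v \<longleftrightarrow> good v u"
  by (simp add: good_def co_commute)

lemma good_adj: "good u v \<Longrightarrow> adj u v"
  using X_ge_300 e_pos by (auto simp: good_def adj_def)

text \<open>There are at most \<open>e\<close> bad pairs altogether, hence at most \<open>e\<close>
  at any one vertex. Every later choice of a good partner among more than \<open>e\<close>
  neighbours rests on this.\<close>

lemma card_not_good:
  assumes "B \<subseteq> {v. adj u v}"
  shows "real (card {v \<in> B. \<not> good u v}) \<le> e"
proof -
  have "Pair u ` {v \<in> B. \<not> good u v} \<subseteq> bad" using assms not_good_bad by auto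
  then have "card (Pair u ` {v \<in> B. \<not> good u v}) \<le> card bad" by (intro card_mono) auto
  moreover have "card (Pair u ` {v \<in> B. \<not> good u v}) = card {v \<in> B. \<not> good u v}"
    by (intro card_image) (auto simp: inj_on_def)
  ultimately show ?thesis using card_bad by linarith
qed

lemma ex_good:
  assumes B: "B \<subseteq> {v. adj u v}" and c: "e < real (card B)"
  shows "\<exists>v\<in>B. good u v"
proof (rule ccontr)
  assume "\<not> ?thesis"
  then have "{v \<in> B. \<not> good u v} = B" by auto
  then show False using card_not_good[OF B] c by simp
qed

lemma ex_good2:
  assumes B: "B \<subseteq> {v. adj u v}" "B \<subseteq> {v. adj u' v}" and c: "2 * e < real (card B)"
  shows "\<exists>v\<in>B. good u v \<and> good u' v"
proof -
  have "finite B" using B(1) finite_adj finite_subset by blast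
  have "B = {v \<in> B. good u v} \<union> {v \<in> B. \<not> good u v}" by auto
  then have "card B \<le> card {v \<in> B. good u v} + card {v \<in> B. \<not> good u v}" using card_Un_le by metis
  then have "e < real (card {v \<in> B. good u v})" using c card_not_good[OF B(1)] by linarith
  moreover have "{v \<in> B. good u v} \<subseteq> {v. adj u' v}" using B by auto
  ultimately show ?thesis using ex_good by blast
qed

lemma card_nonadj_le: "v \<in> V \<Longrightarrow> real (card (nonadj v)) \<le> X + e"
  using nonadj_close[of v] by linarith

section \<open>Large independent sets of the shadow\<close>

lemma big_subset_V: "big J \<Longrightarrow> J \<subseteq> V"
  unfolding big_def using nonadj_subset_V by blast

lemma finite_big: "big J \<Longrightarrow> finite J"
  using big_subset_V finite_V finite_subset by blast

lemma big_nonempty: "big J \<Longrightarrow> J \<noteq> {}"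
  using X_ge_300 e_pos by (auto simp: big_def)

lemma card_big_ge: "big J \<Longrightarrow> X - 2 * e \<le> real (card J)"
  by (simp add: big_def)

lemma card_big_le:
  assumes "big J" shows "real (card J) \<le> X + e"
proof -
  obtain z where z: "z \<in> J" using big_nonempty[OF assms] by blast
  then have "J \<subseteq> nonadj z" "z \<in> V" using assms big_subset_V by (auto simp: big_def)
  then show ?thesis using card_mono[of "nonadj z" J] card_nonadj_le[of z] by simp
qed

lemma big_co: "good u v \<Longrightarrow> big (co u v)"
  using co_subset_nonadj by (auto simp: big_def good_def)

text \<open>The union still lies in \<open>nonadj z\<close>, so it has at most \<open>X + e\<close>
  elements; the loss is 2e + 2e + e.\<close>

lemma card_big_Int:
  assumes J: "big J" "big J'" and z: "z \<in> J" "z \<in> J'"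
  shows "X - 5 * e \<le> real (card (J \<inter> J'))"
proof -
  have "J \<union> J' \<subseteq> nonadj z" "z \<in> V" using assms big_subset_V by (auto simp: big_def)
  then have "real (card (J \<union> J')) \<le> X + e" using card_mono[of "nonadj z" "J \<union> J'"] card_nonadj_le[of z] by simp
  moreover have "card J + card J' = card (J \<union> J') + card (J \<inter> J')"
    using card_Un_Int finite_big J by blast
  ultimately show ?thesis using card_big_ge[OF J(1)] card_big_ge[OF J(2)] by linarith
qed

lemma subsets_meet:
  assumes P: "finite P" "real (card P) \<le> c" and AB: "A \<subseteq> P" "B \<subseteq> P" "c + d < real (card A) + real (card B)"
  shows "d < real (card (A \<inter> B))"
proof -
  have "card A + card B = card (A \<union> B) + card (A \<inter> B)"
    using card_Un_Int finite_subset[OF AB(1) P(1)] finite_subset[OF AB(2) P(1)] by blast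
  moreover have "card (A \<union> B) \<le> card P" using AB P by (intro card_mono) auto
  ultimately show ?thesis using P AB by linarith
qed

lemma big_meet:
  assumes "big J" "A \<subseteq> J" "B \<subseteq> J" "X - 5 * e \<le> real (card A)" "X - 5 * e \<le> real (card B)"
  shows "A \<inter> B \<noteq> {}"
proof -
  have "0 < real (card (A \<inter> B))"
    using X_ge_300 e_pos by (intro subsets_meet[OF finite_big[OF assms(1)] card_big_le[OF assms(1)] assms(2,3)])
      (use assms in linarith)
  then show ?thesis by force
qed

text \<open>The degree of \<open>w\<close> far exceeds \<open>e\<close>, so \<open>w\<close> has a
  good partner \<open>u\<close>. The many elements of \<open>co u w\<close> then include some
  \<open>v\<close> with \<open>good u v\<close>, and \<open>co u v\<close> is a large independent
  set through \<open>w\<close>.\<close>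

lemma ex_big:
  assumes w: "w \<in> V" shows "\<exists>J. big J \<and> w \<in> J"
proof -
  have "real (card {u. adj w u}) = k * X - real (card (nonadj w))"
    using card_adj[OF w] card_V by linarith
  moreover have "3 * X \<le> k * X" using k3 X_ge_300 e_pos by (intro mult_right_mono) auto
  ultimately have "e < real (card {u. adj w u})"
    using card_nonadj_le[OF w] X_ge_300 e_pos by linarith
  then obtain u where u: "good w u" using ex_good[of "{u. adj w u}" w] by blast
  then have "e < real (card (co u w))"
    using X_ge_300 e_pos good_commute by (force simp: good_def)
  moreover have "co u w \<subseteq> {v. adj u v}" using co_subset_adj by blast
  ultimately obtain v where v: "v \<in> co u w" "good u v" using ex_good by blast
  then have "w \<in> co u v" using co_rotate by blast
  then show ?thesis using big_co[OF v(2)] by blast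
qed

text \<open>Large independent sets of the shadow that meet have almost the same elements. So on the sets
  \<open>I w\<close> meeting is an equivalence relation, and \<open>cls w\<close> is the class of \<open>w\<close>.\<close>

definition I :: "'a \<Rightarrow> 'a set" where
  "I w = (SOME J. big J \<and> w \<in> J)"

definition cls :: "'a \<Rightarrow> 'a set" where
  "cls w = {z \<in> V. I z \<inter> I w \<noteq> {}}"

lemma big_I: "w \<in> V \<Longrightarrow> big (I w)" and self_in_I: "w \<in> V \<Longrightarrow> w \<in> I w"
  using someI_ex[OF ex_big, of w] by (auto simp: I_def)

lemma card_I_Int: "x \<in> V \<Longrightarrow> y \<in> V \<Longrightarrow> I x \<inter> I y \<noteq> {} \<Longrightarrow> X - 5 * e \<le> real (card (I x \<inter> I y))"
  using card_big_Int[OF big_I big_I] by blast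

lemma I_meet_trans:
  assumes V: "x \<in> V" "y \<in> V" "z \<in> V" and ne: "I x \<inter> I y \<noteq> {}" "I y \<inter> I z \<noteq> {}"
  shows "I x \<inter> I z \<noteq> {}"
  using big_meet[OF big_I[OF V(2)], of "I x \<inter> I y" "I y \<inter> I z"] card_I_Int[OF V(1,2) ne(1)]
    card_I_Int[OF V(2,3) ne(2)] by blast

lemma self_in_cls: "x \<in> V \<Longrightarrow> x \<in> cls x"
  using self_in_I by (auto simp: cls_def)

lemma cls_subset_V: "cls x \<subseteq> V"
  by (auto simp: cls_def)

lemma finite_cls [simp]: "finite (cls x)"
  using cls_subset_V by (rule finite_subset) simp

lemma cls_eq_iff:
  assumes V: "x \<in> V" "y \<in> V"
  shows "cls x = cls y \<longleftrightarrow> I x \<inter> I y \<noteq> {}"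
proof
  assume "cls x = cls y"
  then show "I x \<inter> I y \<noteq> {}" using self_in_cls[OF V(1)] by (auto simp: cls_def)
next
  assume ne: "I x \<inter> I y \<noteq> {}"
  then have ne': "I y \<inter> I x \<noteq> {}" by blast
  show "cls x = cls y"
  proof (intro equalityI subsetI)
    fix z assume "z \<in> cls x"
    then show "z \<in> cls y" using I_meet_trans[OF _ V _ ne, of z] by (simp add: cls_def)
  next
    fix z assume "z \<in> cls y"
    then show "z \<in> cls x" using I_meet_trans[OF _ V(2,1) _ ne', of z] by (simp add: cls_def)
  qed
qed

lemma in_cls: "z \<in> cls w \<Longrightarrow> w \<in> V \<Longrightarrow> cls z = cls w"
  using cls_eq_iff[of z w] by (simp add: cls_def)

text \<open>For any \<open>y\<close> in \<open>J\<close>, both \<open>I z\<close> and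
  \<open>I y\<close> cover all but O(e) elements of \<open>J\<close>, so they meet inside
  \<open>J\<close>.\<close>

lemma big_subset_cls:
  assumes J: "big J" and z: "z \<in> J"
  shows "J \<subseteq> cls z"
proof
  fix y assume y: "y \<in> J"
  have V: "z \<in> V" "y \<in> V" using J z y big_subset_V by blast+
  have "J \<inter> I z \<inter> (J \<inter> I y) \<noteq> {}"
    using card_big_Int[OF J big_I[OF V(1)] z self_in_I[OF V(1)]]
      card_big_Int[OF J big_I[OF V(2)] y self_in_I[OF V(2)]] by (intro big_meet[OF J]) auto
  then show "y \<in> cls z" using V by (auto simp: cls_def)
qed

lemma I_subset_cls: "w \<in> V \<Longrightarrow> I w \<subseteq> cls w"
  using big_subset_cls big_I self_in_I by blast

lemma I_subset_nonadj: "w \<in> V \<Longrightarrow> I w \<subseteq> nonadj w"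
  using big_I self_in_I by (auto simp: big_def)

section \<open>Size and number of the classes\<close>

lemma card_cls_ge: "w \<in> V \<Longrightarrow> X - 2 * e \<le> real (card (cls w))"
  using card_mono[OF finite_cls I_subset_cls, of w] card_big_ge[OF big_I, of w] by linarith

text \<open>Double counting of the pairs z in \<open>cls w\<close>, y in \<open>I w\<close> with y
  in \<open>I z\<close>: each z has at least \<open>X - 5 * e\<close> partners, while for fixed y
  all such z lie in \<open>nonadj y\<close>. The quotient (X + e)^2 / (X - 5e) is less than X + 8e
  once X > 41e.\<close>

lemma card_cls_le:
  assumes w: "w \<in> V" shows "real (card (cls w)) \<le> X + 8 * e"
proof -
  have fI: "finite (I w)" using big_I[OF w] finite_big by blast
  have "real (card (cls w)) * (X - 5 * e) = (\<Sum>z\<in>cls w. X - 5 * e)" by simp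
  also have "\<dots> \<le> (\<Sum>z\<in>cls w. real (card (I z \<inter> I w)))"
    using card_I_Int w by (intro sum_mono) (auto simp: cls_def)
  also have "\<dots> = (\<Sum>z\<in>cls w. \<Sum>y\<in>I w. if y \<in> I z then 1 else 0)"
  proof (rule sum.cong[OF refl])
    fix z
    have "I w \<inter> {y. y \<in> I z} = I z \<inter> I w" by blast
    then show "real (card (I z \<inter> I w)) = (\<Sum>y\<in>I w. if y \<in> I z then 1 else 0)"
      using fI by (subst sum.If_cases) simp_all
  qed
  also have "\<dots> = (\<Sum>y\<in>I w. \<Sum>z\<in>cls w. if y \<in> I z then 1 else 0)" by (rule sum.swap)
  also have "\<dots> \<le> (\<Sum>y\<in>I w. X + e)"
  proof (rule sum_mono)
    fix y assume "y \<in> I w"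
    then have y: "y \<in> V" using big_subset_V[OF big_I[OF w]] by blast
    have "cls w \<inter> {z. y \<in> I z} \<subseteq> nonadj y"
    proof
      fix z assume z: "z \<in> cls w \<inter> {z. y \<in> I z}"
      then have "z \<in> V" by (simp add: cls_def)
      then show "z \<in> nonadj y" using big_I[of z] self_in_I[of z] z by (auto simp: big_def)
    qed
    then have "card (cls w \<inter> {z. y \<in> I z}) \<le> card (nonadj y)" by (intro card_mono) auto
    then have "real (card (cls w \<inter> {z. y \<in> I z})) \<le> X + e" using card_nonadj_le[OF y] by linarith
    then show "(\<Sum>z\<in>cls w. if y \<in> I z then 1 else 0) \<le> X + e" by (subst sum.If_cases) simp_all
  qed
  also have "\<dots> = real (card (I w)) * (X + e)" by simp
  also have "\<dots> \<le> (X + e) * (X + e)"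
    using card_big_le[OF big_I[OF w]] X_ge_300 e_pos by (intro mult_right_mono) auto
  finally have le: "real (card (cls w)) * (X - 5 * e) \<le> (X + e) * (X + e)" .
  show ?thesis
  proof (rule ccontr)
    assume "\<not> ?thesis"
    then have "(X + 8 * e) * (X - 5 * e) \<le> real (card (cls w)) * (X - 5 * e)"
      using X_ge_300 e_pos by (intro mult_right_mono) auto
    then have "(X + 8 * e) * (X - 5 * e) \<le> (X + e) * (X + e)" using le by linarith
    then have "e * X \<le> e * (41 * e)" by (simp add: algebra_simps)
    then have "X \<le> 41 * e" using e_pos by simp
    then show False using X_ge_300 e_pos by linarith
  qed
qed

text \<open>\<open>I w\<close> lies in both \<open>nonadj w\<close> and \<open>cls w\<close> and
  nearly exhausts each. So at every vertex, nonadjacency and the class relation disagree on O(e)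
  vertices only.\<close>

lemma card_nonadj_minus_cls:
  assumes w: "w \<in> V" shows "real (card (nonadj w - cls w)) \<le> 3 * e"
proof -
  have "card (nonadj w - cls w) \<le> card (nonadj w - I w)"
    using I_subset_cls[OF w] by (intro card_mono) auto
  also have "\<dots> = card (nonadj w) - card (I w)"
    using I_subset_nonadj[OF w] by (intro card_Diff_subset finite_big big_I w)
  finally show ?thesis using card_nonadj_le[OF w] card_big_ge[OF big_I[OF w]]
      card_mono[OF finite_nonadj I_subset_nonadj[OF w]] by linarith
qed

lemma card_cls_minus_nonadj:
  assumes w: "w \<in> V" shows "real (card (cls w - nonadj w)) \<le> 10 * e"
proof -
  have "card (cls w - nonadj w) \<le> card (cls w - I w)"
    using I_subset_nonadj[OF w] by (intro card_mono) auto
  also have "\<dots> = card (cls w) - card (I w)"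
    using I_subset_cls[OF w] by (intro card_Diff_subset finite_big big_I w)
  finally show ?thesis using card_cls_le[OF w] card_big_ge[OF big_I[OF w]]
      card_mono[OF finite_cls I_subset_cls[OF w]] by linarith
qed

text \<open>The \<open>k * X\<close> vertices split into classes of sizes between
  \<open>X - 2 * e\<close> and \<open>X + 8 * e\<close>. Since
  \<open>X \<ge> 100 * real k * e\<close>, the accumulated error of order k e is smaller than one
  class.\<close>

lemma card_classes: "card (cls ` V) = k"
proof -
  define j where "j = card (cls ` V)"
  have "(\<Union>P\<in>cls ` V. P) = V" using self_in_cls cls_subset_V by blast
  moreover have "card (\<Union>P\<in>cls ` V. P) = (\<Sum>P\<in>cls ` V. card P)"
  proof (rule card_UN_disjoint)
    show "\<forall>P\<in>cls ` V. \<forall>Q\<in>cls ` V. P \<noteq> Q \<longrightarrow> P \<inter> Q = {}" using in_cls by blast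
  qed auto
  ultimately have sum: "(\<Sum>P\<in>cls ` V. real (card P)) = k * X" using card_V by (simp flip: of_nat_sum)
  have "(\<Sum>P\<in>cls ` V. X - 2 * e) \<le> (\<Sum>P\<in>cls ` V. real (card P))"
    using card_cls_ge by (intro sum_mono) auto
  then have 1: "real j * (X - 2 * e) \<le> k * X" unfolding sum by (simp add: j_def)
  have "(\<Sum>P\<in>cls ` V. real (card P)) \<le> (\<Sum>P\<in>cls ` V. X + 8 * e)"
    using card_cls_le by (intro sum_mono) auto
  then have 2: "k * X \<le> real j * (X + 8 * e)" unfolding sum by (simp add: j_def)
  have ke: "real k * e \<ge> e" using k3 e_pos by simp
  have "\<not> j \<ge> k + 1"
  proof
    assume "j \<ge> k + 1"
    then have "(real k + 1) * (X - 2 * e) \<le> real j * (X - 2 * e)"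
      using X_ge_300 e_pos by (intro mult_right_mono) auto
    then have "(real k + 1) * (X - 2 * e) \<le> k * X" using 1 by linarith
    then have "X \<le> 2 * (real k * e) + 2 * e" by (simp add: algebra_simps)
    then show False using X_ge ke e_pos by linarith
  qed
  moreover have "\<not> j + 1 \<le> k"
  proof
    assume "j + 1 \<le> k"
    then have "real j * (X + 8 * e) \<le> (real k - 1) * (X + 8 * e)"
      using X_ge_300 e_pos by (intro mult_right_mono) auto
    then have "k * X \<le> (real k - 1) * (X + 8 * e)" using 2 by linarith
    then have "X + 8 * e \<le> 8 * (real k * e)" by (simp add: algebra_simps)
    then show False using X_ge ke e_pos by linarith
  qed
  ultimately show ?thesis by (simp add: j_def)
qed

section \<open>The third class determined by two classes\<close>

text \<open>If u, w were good, \<open>co u w\<close> would contain v and so lie in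
  \<open>cls u\<close>; but it consists of neighbours of u, of which \<open>cls u\<close> has at
  most 10e. If u, v were good, some w' in \<open>co u v\<close> would form a good pair with u, which
  was just excluded.\<close>

lemma not_good_if_same_class:
  assumes w: "w \<in> co u v" and eq: "cls u = cls v"
  shows "\<not> good u v" "\<not> good u w" "\<not> good v w"
proof -
  have *: "\<not> good u w" if w: "w \<in> co u v" and eq: "cls u = cls v" for u v w
  proof
    assume g: "good u w"
    have v: "v \<in> co u w" using w co_rotate by blast
    have u: "u \<in> V" using coD[OF w] by blast
    have "co u w \<subseteq> cls u" using big_subset_cls[OF big_co[OF g] v] eq by simp
    moreover have "co u w \<inter> nonadj u = {}" using co_subset_adj by (auto simp: nonadj_def)
    ultimately have "co u w \<subseteq> cls u - nonadj u" by blast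
    then have "card (co u w) \<le> card (cls u - nonadj u)" by (intro card_mono) auto
    then show False using card_cls_minus_nonadj[OF u] g X_ge_300 e_pos unfolding good_def by linarith
  qed
  show "\<not> good u w" using *[OF w eq] .
  show "\<not> good v w" using *[of w v u] w eq co_commute by metis
  show "\<not> good u v"
  proof
    assume g: "good u v"
    have "co u v \<subseteq> {w. adj u w}" using co_subset_adj by blast
    moreover have "e < real (card (co u v))" using g X_ge_300 e_pos unfolding good_def by linarith
    ultimately obtain w' where "w' \<in> co u v" "good u w'" using ex_good by blast
    then show False using * eq by blast
  qed
qed

lemma ex_all_good:
  assumes g: "good u v" and w: "w \<in> co u v"
  shows "\<exists>x\<in>co u v. cls x = cls w \<and> good u x \<and> good v x"
proof -
  have "co u v \<subseteq> {w. adj u w}" "co u v \<subseteq> {w. adj v w}" using co_subset_adj by blast+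
  moreover have "2 * e < real (card (co u v))" using g X_ge_300 e_pos unfolding good_def by linarith
  ultimately obtain x where x: "x \<in> co u v" "good u x" "good v x" using ex_good2 by blast
  then have "x \<in> cls w" using big_subset_cls[OF big_co[OF g] w] by blast
  then have "cls x = cls w" using in_cls coD(3)[OF w] by blast
  then show ?thesis using x by blast
qed

text \<open>Replace w and w' by x and x' that are good for u. Then \<open>co u x\<close> and
  \<open>co u x'\<close> are large subsets of the class of v, so they share some y with
  \<open>good u y\<close>, and x and x' both lie in the one set \<open>co u y\<close>.\<close>

lemma third_class_same_vertex:
  assumes g: "good u v" "good u v'" and eq: "cls v = cls v'" and w: "w \<in> co u v" "w' \<in> co u v'"
  shows "cls w = cls w'"
proof -
  obtain x where x: "x \<in> co u v" "cls x = cls w" "good u x" using ex_all_good[OF g(1) w(1)] by blast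
  obtain x' where x': "x' \<in> co u v'" "cls x' = cls w'" "good u x'" using ex_all_good[OF g(2) w(2)] by blast
  have v: "v \<in> co u x" "v' \<in> co u x'" using x x' co_rotate by blast+
  have V: "v \<in> V" using v coD by blast
  have sub: "co u x \<subseteq> cls v" "co u x' \<subseteq> cls v"
    using big_subset_cls[OF big_co[OF x(3)] v(1)] big_subset_cls[OF big_co[OF x'(3)] v(2)] eq by auto
  have "e < real (card (co u x \<inter> co u x'))"
    using x(3) x'(3) X_ge_300 e_pos
    by (intro subsets_meet[OF finite_cls card_cls_le[OF V] sub]) (simp add: good_def)
  moreover have "co u x \<inter> co u x' \<subseteq> {v. adj u v}" using co_subset_adj by blast
  ultimately obtain y where y: "y \<in> co u x" "y \<in> co u x'" "good u y" using ex_good by blast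
  then have xy: "x \<in> co u y" "x' \<in> co u y" using co_rotate by blast+
  then have "x' \<in> cls x" using big_subset_cls[OF big_co[OF y(3)]] by blast
  then have "cls x' = cls x" using in_cls coD(3)[OF xy(1)] by blast
  then show ?thesis using x x' by simp
qed

lemma ex_common_good:
  assumes V: "u \<in> V" "u' \<in> V" "v \<in> V" and eq: "cls u = cls u'" and ne: "cls u \<noteq> cls v"
  shows "\<exists>x\<in>cls v. good u x \<and> good u' x"
proof -
  define B where "B = I v - (nonadj u - cls u) - (nonadj u' - cls u')"
  have disj: "cls v \<inter> cls u = {}" using ne in_cls V by blast
  have Iv: "I v \<subseteq> cls v" "I v \<subseteq> V" using I_subset_cls V cls_subset_V by blast+
  have adj: "B \<subseteq> {x. adj u x}" "B \<subseteq> {x. adj u' x}"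
    using disj Iv eq by (auto simp: B_def nonadj_def)
  have "card (I v) - card (nonadj u - cls u) \<le> card (I v - (nonadj u - cls u))"
    by (rule diff_card_le_card_Diff) simp
  moreover have "card (I v - (nonadj u - cls u)) - card (nonadj u' - cls u') \<le> card B"
    unfolding B_def by (rule diff_card_le_card_Diff) simp
  ultimately have "2 * e < real (card B)"
    using card_nonadj_minus_cls[OF V(1)] card_nonadj_minus_cls[OF V(2)] card_big_ge[OF big_I[OF V(3)]]
      X_ge_300 e_pos by linarith
  then obtain x where "x \<in> B" "good u x" "good u' x" using ex_good2[OF adj] by blast
  then show ?thesis using Iv by (auto simp: B_def)
qed

text \<open>One vertex changes at a time: (u, v), (u, x), (u', x), (u', v'), with x in the class of
  v good for both u and u'. The detour through x avoids (u', v) and (u, v'), which may fail to be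
  good.\<close>

lemma third_class:
  assumes g: "good u v" "good u' v'" and eq: "cls u = cls u'" "cls v = cls v'"
    and w: "w \<in> co u v" "w' \<in> co u' v'"
  shows "cls w = cls w'"
proof -
  have V: "u \<in> V" "u' \<in> V" "v \<in> V" using coD w by blast+
  have "cls u \<noteq> cls v" using not_good_if_same_class(1)[OF w(1)] g(1) by blast
  then obtain x where x: "x \<in> cls v" "good u x" "good u' x" using ex_common_good[OF V eq(1)] by blast
  have xv: "cls x = cls v" using in_cls x V by blast
  obtain y where y: "y \<in> co u x" using good_adj[OF x(2)] by (auto simp: adj_def)
  obtain y' where y': "y' \<in> co u' x" using good_adj[OF x(3)] by (auto simp: adj_def)
  have "cls w = cls y" using third_class_same_vertex[OF g(1) x(2) _ w(1) y] xv by simp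
  also have "\<dots> = cls y'"
  proof (rule third_class_same_vertex)
    show "good x u" "good x u'" using x(2,3) good_commute by blast+
    show "y \<in> co x u" "y' \<in> co x u'" using y y' by (simp_all only: co_commute[of x])
  qed (rule eq(1))
  also have "\<dots> = cls w'" using third_class_same_vertex[OF x(3) g(2) _ y' w(2)] xv eq by simp
  finally show ?thesis .
qed

text \<open>Requiring all three pairs to be good makes the definition symmetric in the three
  vertices; \<open>triples_if_good\<close> shows that one good pair suffices.\<close>

definition triples :: "'a set set set" where
  "triples = {{cls u, cls v, cls w} | u v w. w \<in> co u v \<and> good u v \<and> good u w \<and> good v w}"

lemma triples_if_good:
  assumes "good u v" "w \<in> co u v" shows "{cls u, cls v, cls w} \<in> triples"
proof -
  obtain x where x: "x \<in> co u v" "cls x = cls w" "good u x" "good v x"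
    using ex_all_good[OF assms] by blast
  then have "{cls u, cls v, cls x} \<in> triples" using assms(1) unfolding triples_def by blast
  then show ?thesis using x(2) by simp
qed

lemma cls_distinct:
  assumes "good u v" "w \<in> co u v"
  shows "cls u \<noteq> cls v" "cls u \<noteq> cls w" "cls v \<noteq> cls w"
proof -
  have w: "v \<in> co u w" "u \<in> co v w" using assms(2) co_rotate co_commute by metis+
  show "cls u \<noteq> cls v" using not_good_if_same_class(1)[OF assms(2)] assms(1) by blast
  show "cls u \<noteq> cls w" using not_good_if_same_class(2)[OF w(1)] assms(1) by blast
  show "cls v \<noteq> cls w" using not_good_if_same_class(2)[OF w(2)] assms(1) good_commute by blast
qed

lemma triples_pairE:
  assumes E: "E \<in> triples" and PQ: "P \<in> E" "Q \<in> E" "P \<noteq> Q"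
  obtains u v w where "w \<in> co u v" "good u v" "P = cls u" "Q = cls v" "E = {P, Q, cls w}"
proof -
  obtain u v w where E': "E = {cls u, cls v, cls w}" and uvw: "w \<in> co u v" "good u v" "good u w" "good v w"
    using E unfolding triples_def by blast
  have c: "w \<in> co v u" "v \<in> co u w" "v \<in> co w u" "u \<in> co v w" "u \<in> co w v"
    using uvw(1) by (simp_all add: co_def insert_commute)
  have g: "good v u" "good w u" "good w v" using uvw good_commute by blast+
  consider "P = cls u" "Q = cls v" | "P = cls u" "Q = cls w" | "P = cls v" "Q = cls u"
    | "P = cls v" "Q = cls w" | "P = cls w" "Q = cls u" | "P = cls w" "Q = cls v"
    using PQ unfolding E' insert_iff by (elim disjE) simp_all
  then show thesis
  proof cases
    case 1 then show thesis using that[OF uvw(1,2)] E' by simp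
  next
    case 2 then show thesis using that[OF c(2) uvw(3)] E' by (simp add: insert_commute)
  next
    case 3 then show thesis using that[OF c(1) g(1)] E' by (simp add: insert_commute)
  next
    case 4 then show thesis using that[OF c(4) uvw(4)] E' by (simp add: insert_commute)
  next
    case 5 then show thesis using that[OF c(3) g(2)] E' by (simp add: insert_commute)
  next
    case 6 then show thesis using that[OF c(5) g(3)] E' by (simp add: insert_commute)
  qed
qed

lemma ex_triple:
  assumes V: "u \<in> V" "v \<in> V" and ne: "cls u \<noteq> cls v"
  shows "\<exists>w\<in>V. {cls u, cls v, cls w} \<in> triples \<and> cls w \<noteq> cls u \<and> cls w \<noteq> cls v"
proof -
  obtain x where x: "x \<in> cls v" "good u x" using ex_common_good[OF V(1,1,2) refl ne] by blast
  then obtain w where w: "w \<in> co u x" using good_adj[OF x(2)] by (auto simp: adj_def)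
  have "cls x = cls v" using in_cls x V by blast
  then show ?thesis using triples_if_good[OF x(2) w] cls_distinct[OF x(2) w] coD(3)[OF w] by auto
qed

lemma triples_steiner: "steiner_triple_system k (cls ` V) triples"
proof -
  have "three_graph (cls ` V) triples" unfolding three_graph_def
  proof (intro conjI subsetI)
    fix E assume "E \<in> triples"
    then obtain u v w where E: "E = {cls u, cls v, cls w}" and uvw: "w \<in> co u v" "good u v"
      unfolding triples_def by blast
    then show "E \<in> {E. E \<subseteq> cls ` V \<and> card E = 3}"
      using cls_distinct[OF uvw(2,1)] coD(1,2,3)[OF uvw(1)] by simp
  qed simp
  moreover have "\<exists>!E. E \<in> triples \<and> P \<subseteq> E" if P: "P \<subseteq> cls ` V" "card P = 2" for P
  proof -
    obtain A B where AB: "P = {A, B}" "A \<noteq> B" using P(2) by (auto simp: card_2_iff)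
    then obtain u v where uv: "A = cls u" "B = cls v" "u \<in> V" "v \<in> V" using P(1) by auto
    then obtain w where w: "{A, B, cls w} \<in> triples" using ex_triple[of u v] AB(2) by blast
    show ?thesis
    proof (rule ex1I[of _ "{A, B, cls w}"])
      show "{A, B, cls w} \<in> triples \<and> P \<subseteq> {A, B, cls w}" using w AB by simp
    next
      fix E assume E: "E \<in> triples \<and> P \<subseteq> E"
      obtain u1 v1 w1 where 1: "w1 \<in> co u1 v1" "good u1 v1" "A = cls u1" "B = cls v1" "{A, B, cls w} = {A, B, cls w1}"
        by (rule triples_pairE[OF w _ _ AB(2)]) simp_all
      obtain u2 v2 w2 where 2: "w2 \<in> co u2 v2" "good u2 v2" "A = cls u2" "B = cls v2" "E = {A, B, cls w2}"
        by (rule triples_pairE[OF _ _ _ AB(2), of E]) (use E AB(1) in simp_all)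
      have "cls w1 = cls w2" using third_class[OF 1(2) 2(2) _ _ 1(1) 2(1)] 1(3,4) 2(3,4) by simp
      then show "E = {A, B, cls w}" by (simp only: 1(5) 2(5))
    qed
  qed
  ultimately show ?thesis using card_classes by (simp add: steiner_triple_system_def)
qed

section \<open>Comparison with the full blowup over the classes\<close>

definition ideal :: "'a set set" where
  "ideal = {E. E \<subseteq> V \<and> card E = 3 \<and> cls ` E \<in> triples}"

lemma three_graph_ideal: "three_graph V ideal"
  by (auto simp: three_graph_def ideal_def)

lemma finite_ideal [simp]: "finite ideal"
  by (rule finite_subset[of _ "Pow V"]) (auto simp: ideal_def)

lemma blowup_ideal: "blowup V ideal (cls ` V) triples"
  unfolding blowup_def ideal_def by (intro bexI[of _ cls]) auto

lemma in_ideal: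
  assumes "x \<in> V" "y \<in> V" "z \<in> V" "{cls x, cls y, cls z} \<in> triples"
    and ne: "cls x \<noteq> cls y" "cls x \<noteq> cls z" "cls y \<noteq> cls z"
  shows "{x, y, z} \<in> ideal"
proof -
  have "x \<noteq> y" "x \<noteq> z" "y \<noteq> z" using ne by blast+
  then show ?thesis using assms by (simp add: ideal_def)
qed

text \<open>A single good pair would put the edge over a triple of classes. By symmetry all three
  pairs are bad; two sharing a vertex are recorded, as these determine the edge.\<close>

lemma not_ideal_all_bad:
  assumes w: "w \<in> co u v" and E: "{u, v, w} \<notin> ideal"
  shows "(u, v) \<in> bad" "(v, w) \<in> bad"
proof -
  have *: "(u, v) \<in> bad" if "w \<in> co u v" "{u, v, w} \<notin> ideal" for u v w
  proof (rule not_good_bad)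
    show "adj u v" using that(1) by (rule adjI)
    show "\<not> good u v"
    proof
      assume g: "good u v"
      show False using in_ideal[OF coD(1-3)[OF that(1)] triples_if_good[OF g that(1)] cls_distinct[OF g that(1)]]
          that(2) by blast
    qed
  qed
  show "(u, v) \<in> bad" using * assms .
  have "u \<in> co v w" "{v, w, u} \<notin> ideal" using w E by (simp_all add: co_def insert_commute)
  then show "(v, w) \<in> bad" by (rule *)
qed

lemma card_outside_ideal: "card (H - ideal) \<le> (card bad)\<^sup>2"
proof -
  have "H - ideal \<subseteq> (\<lambda>(p, q). {fst p, snd p, snd q}) ` (bad \<times> bad)"
  proof
    fix E assume E: "E \<in> H - ideal"
    then have "card E = 3" using edgeD by blast
    then obtain u v w where uvw: "E = {u, v, w}" by (auto simp: card_3_iff)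
    then have w: "w \<in> co u v" using E by (simp add: co_def)
    have "((u, v), (v, w)) \<in> bad \<times> bad" using not_ideal_all_bad[OF w] E uvw by simp
    then show "E \<in> (\<lambda>(p, q). {fst p, snd p, snd q}) ` (bad \<times> bad)" unfolding uvw by force
  qed
  then have "card (H - ideal) \<le> card ((\<lambda>(p, q). {fst p, snd p, snd q}) ` (bad \<times> bad))"
    by (intro card_mono) auto
  also have "\<dots> \<le> card (bad \<times> bad)" by (intro card_image_le) auto
  finally show ?thesis by (simp add: card_cartesian_product power2_eq_square)
qed

text \<open>The blowup edges {u, x, y} and {v, x, y} cannot both be in \<open>H\<close>, for then
  the adjacent vertices u and v would both lie in \<open>co x y\<close>. So every y in
  \<open>cls z\<close> accounts for a missing edge, from which y is recovered as the only vertex in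
  \<open>cls z\<close>.\<close>

lemma many_missing_same_class:
  assumes w: "w \<in> co u v" and eq: "cls u = cls v"
  shows "e < real (card (ideal - H))"
proof -
  note V = coD(1,2)[OF w]
  have "card (cls ` V) \<noteq> 1" using card_classes k3 by simp
  then have "cls ` V \<noteq> {cls u}" by auto
  then obtain x where x: "x \<in> V" "cls x \<noteq> cls u" using V by blast
  obtain z where z: "z \<in> V" "{cls u, cls x, cls z} \<in> triples" "cls z \<noteq> cls u" "cls z \<noteq> cls x"
    using ex_triple[OF V(1) x(1)] x(2) by metis
  define f where "f y = (if {u, x, y} \<in> H then {v, x, y} else {u, x, y})" for y
  have f: "f y \<in> ideal - H \<and> f y \<inter> cls z = {y}" if y: "y \<in> cls z" for y
  proof -
    have yV: "y \<in> V" and yz: "cls y = cls z" using y cls_subset_V in_cls z by blast+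
    have i: "{u, x, y} \<in> ideal" "{v, x, y} \<in> ideal"
      using in_ideal[of _ x y] V x yV z yz eq by metis+
    have "u \<notin> cls z" "v \<notin> cls z" "x \<notin> cls z" using in_cls z x eq by metis+
    then have "{u, x, y} \<inter> cls z = {y}" "{v, x, y} \<inter> cls z = {y}" using y by auto
    moreover have "\<not> ({u, x, y} \<in> H \<and> {v, x, y} \<in> H)"
    proof
      assume "{u, x, y} \<in> H \<and> {v, x, y} \<in> H"
      then have "u \<in> co x y" "v \<in> co x y" by (simp_all add: co_def insert_commute)
      then show False using co_independent adjI[OF w] by blast
    qed
    ultimately show ?thesis using i by (auto simp: f_def)
  qed
  have "inj_on f (cls z)"
  proof (rule inj_onI)
    fix y y' assume "y \<in> cls z" "y' \<in> cls z" "f y = f y'"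
    then have "{y} = {y'}" using f by metis
    then show "y = y'" by simp
  qed
  moreover have "f ` cls z \<subseteq> ideal - H" using f by blast
  ultimately have "card (cls z) \<le> card (ideal - H)" by (rule card_inj_on_le) simp
  then show ?thesis using card_cls_ge[OF z(1)] X_ge_300 e_pos by linarith
qed

text \<open>As the edge is not in \<open>ideal\<close>, \<open>cls w\<close> differs from the third
  class \<open>cls z\<close> belonging to u and v. Any y with {u, v, y} in \<open>H\<close> lies in
  \<open>nonadj w\<close>, which has at most 3e vertices outside \<open>cls w\<close>; so nearly all
  y in \<open>I z\<close> yield missing edges.\<close>

lemma many_missing_distinct_classes:
  assumes w: "w \<in> co u v" and E: "{u, v, w} \<notin> ideal"
    and ne: "cls u \<noteq> cls v" "cls u \<noteq> cls w" "cls v \<noteq> cls w"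
  shows "e < real (card (ideal - H))"
proof -
  note V = coD(1-3)[OF w]
  obtain z where z: "z \<in> V" "{cls u, cls v, cls z} \<in> triples" "cls z \<noteq> cls u" "cls z \<noteq> cls v"
    using ex_triple[OF V(1,2) ne(1)] by blast
  have zw: "cls z \<noteq> cls w" using in_ideal[OF V _ ne] z E by metis
  define B where "B = I z - (nonadj w - cls w)"
  have B: "{u, v, y} \<in> ideal - H" if y: "y \<in> B" for y
  proof -
    have yz: "y \<in> cls z" using y I_subset_cls[OF z(1)] by (auto simp: B_def)
    then have yV: "y \<in> V" and yz: "cls y = cls z" using cls_subset_V in_cls z by blast+
    have "{u, v, y} \<in> ideal" using in_ideal[OF V(1,2) yV] z yz ne by metis
    moreover have "{u, v, y} \<notin> H"
    proof
      assume "{u, v, y} \<in> H"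
      then have "y \<in> co u v" by (simp add: co_def)
      then have "y \<in> nonadj w" using co_subset_nonadj[OF w] by blast
      moreover have "y \<notin> cls w" using in_cls[of y w] V yz zw by auto
      ultimately show False using y by (simp add: B_def)
    qed
    ultimately show ?thesis by blast
  qed
  have "inj_on (\<lambda>y. {u, v, y}) B"
  proof (rule inj_onI)
    fix y y' assume y: "y \<in> B" "y' \<in> B" and eq: "{u, v, y} = {u, v, y'}"
    have "y \<noteq> u" "y \<noteq> v" using B[OF y(1)] by (auto simp: ideal_def card_insert_if split: if_splits)
    moreover have "y \<in> {u, v, y'}" unfolding eq [symmetric] by simp
    ultimately show "y = y'" by simp
  qed
  moreover have "(\<lambda>y. {u, v, y}) ` B \<subseteq> ideal - H" using B by blast
  ultimately have "card B \<le> card (ideal - H)" by (rule card_inj_on_le) simp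
  moreover have "card (I z) - card (nonadj w - cls w) \<le> card B"
    unfolding B_def by (rule diff_card_le_card_Diff) simp
  ultimately show ?thesis using card_nonadj_minus_cls[OF V(3)] card_big_ge[OF big_I[OF z(1)]]
      X_ge_300 e_pos by linarith
qed

lemma many_missing:
  assumes "E \<in> H - ideal"
  shows "e < real (card (ideal - H))"
proof -
  have "card E = 3" using assms edgeD by blast
  then obtain u v w where uvw: "E = {u, v, w}" by (auto simp: card_3_iff)
  then have w: "w \<in> co u v" using assms by (simp add: co_def)
  then have w': "v \<in> co u w" "u \<in> co v w" using co_rotate co_commute by metis+
  show ?thesis
    using many_missing_same_class[OF w] many_missing_same_class[OF w'(1)] many_missing_same_class[OF w'(2)]
      many_missing_distinct_classes[OF w] assms uvw by blast
qed

lemma ideal_bound: "card H < card ideal \<or> H \<subseteq> ideal"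
proof (cases "H \<subseteq> ideal")
  case False
  then obtain E where "E \<in> H - ideal" by blast
  then have "e < real (card (ideal - H))" by (rule many_missing)
  moreover have "real (card (H - ideal)) \<le> e"
    using card_outside_ideal card_bad_sq by (metis of_nat_le_iff of_nat_power order_trans)
  ultimately have "card (H - ideal) < card (ideal - H)" by linarith
  moreover have "card H = card (H \<inter> ideal) + card (H - ideal)" "card ideal = card (H \<inter> ideal) + card (ideal - H)"
    using card_Int_Diff[of H ideal] card_Int_Diff[of ideal H] by (simp_all add: Int_commute)
  ultimately show ?thesis by simp
qed simp

theorem near_extremal_bound:
  "card H \<le> s_max (card V) k \<and> (card H = s_max (card V) k \<longrightarrow> blowup V H (cls ` V) triples)"
proof -
  have le: "card ideal \<le> s_max (card V) k"
    by (rule card_le_s_max[OF three_graph_ideal refl triples_steiner blowup_ideal])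
  show ?thesis
  proof (cases "H = ideal")
    case True then show ?thesis using le blowup_ideal by simp
  next
    case False
    then have "card H < card ideal" using ideal_bound psubset_card_mono[of ideal H] by auto
    then show ?thesis using le by simp
  qed
qed

end

section \<open>The slack for shadows of Turan size\<close>

text \<open>The expression is the average size of \<open>nonadj v\<close>, for a shadow with
  \<open>t2 n k\<close> pairs, minus n / k. With r = n mod k it equals r (k - r) / (k n).\<close>

lemma turan_degree:
  assumes k: "k \<ge> 3" and n: "n > 0"
  shows "0 \<le> real n - 2 * real (t2 n k) / n - real n / k"
    and "real n - 2 * real (t2 n k) / n - real n / k \<le> k / n"
proof -
  define q r where "q = n div k" and "r = n mod k"
  have rk: "r < k" and nq: "n = k * q + r" using k by (simp_all add: q_def r_def)
  have "2 * real (t2 n k) + (real k - r) * q ^ 2 + r * (1 + real q) ^ 2 = real n ^ 2"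
    using arg_cong[OF t2_eq[of k n], of real] k rk unfolding q_def [symmetric] r_def [symmetric]
    by (simp add: of_nat_diff)
  then have t: "2 * real (t2 n k) = real n ^ 2 - (real k - r) * q ^ 2 - r * (1 + real q) ^ 2" by simp
  have eq: "real n - 2 * real (t2 n k) / n - real n / k = r * (real k - r) / (real k * n)"
    using k n unfolding t by (simp add: field_simps) (simp add: nq algebra_simps power2_eq_square)
  show "0 \<le> real n - 2 * real (t2 n k) / n - real n / k" unfolding eq using rk by simp
  have "real r * (real k - r) \<le> real k * real k" using rk by (intro mult_mono) auto
  then have "r * (real k - r) / (real k * n) \<le> real k * real k / (real k * n)" by (intro divide_right_mono) auto
  then show "real n - 2 * real (t2 n k) / n - real n / k \<le> k / n" unfolding eq using k by simp
qed

text \<open>The main term (K - 1) K (N / K)^3 is expanded with N / K = q + r / K; its parts of order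
  q^3 and q^2 r are those of \<open>s_max_lower_bound\<close>. The remaining parts are at most 4 (K
  - 1) N, and the deviation \<open>z\<close> of the Turan graph from N / K costs at most K N, which
  together stay below 5 K N.\<close>

lemma turan_slack:
  assumes k: "k \<ge> 3" and S: "steiner_triple_system k W S" and n: "n > 0"
  shows "2 * real (t2 n k) * n - 4 * (real (t2 n k))\<^sup>2 / n - 6 * real (s_max n k) \<le> 5 * real k * n"
proof -
  define q r where "q = real (n div k)" and "r = real (n mod k)"
  define K N where "K = real k" and "N = real n"
  have K: "K \<ge> 3" and N: "N > 0" and r: "0 \<le> r" "r \<le> K" and q: "0 \<le> q" using k n by (simp_all add: K_def N_def r_def q_def less_imp_le)
  have "n = k * (n div k) + n mod k" by simp
  then have Nq: "N = K * q + r" unfolding K_def N_def q_def r_def by (metis of_nat_add of_nat_mult)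
  have "real (k * (k - 1) * (n div k) ^ 3 + 3 * (k - 1) * (n mod k) * (n div k) ^ 2) \<le> real (6 * s_max n k)"
    using s_max_lower_bound[OF S, of n] k unfolding of_nat_le_iff by simp
  then have low: "K * (K - 1) * q ^ 3 + 3 * (K - 1) * r * q ^ 2 \<le> 6 * real (s_max n k)"
    using k by (simp add: K_def q_def r_def of_nat_diff)
  define z where "z = N - 2 * real (t2 n k) / N - N / K"
  have z: "0 \<le> z" "z \<le> K / N" using turan_degree[OF k n] by (auto simp: z_def K_def N_def)
  have expand: "N * (N - x - z) * (x + z) = N * (N - x) * x + N * z * (N - 2 * x) - N * z ^ 2" for x
    by (simp add: algebra_simps power2_eq_square)
  define a where "a = N - N / K - z"
  have t: "real (t2 n k) = N * a / 2" using N by (simp add: a_def z_def)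
  have "2 * real (t2 n k) * N - 4 * (real (t2 n k))\<^sup>2 / N = N * a * (N - a)"
    unfolding t using N by (simp add: field_simps power2_eq_square)
  also have "\<dots> = N * (N - N / K - z) * (N / K + z)" by (simp add: a_def)
  also have "\<dots> = N * (N - N / K) * (N / K) + N * z * (N - 2 * (N / K)) - N * z ^ 2"
    by (rule expand)
  also have "\<dots> \<le> N * (N - N / K) * (N / K) + K * N"
  proof -
    have "N * z * (N - 2 * (N / K)) \<le> N * (K / N) * N"
      using z N K by (intro mult_mono mult_left_mono) (simp_all add: field_simps)
    then have "N * z * (N - 2 * (N / K)) \<le> K * N" using N by simp
    moreover have "0 \<le> N * z ^ 2" using N by simp
    ultimately show ?thesis by linarith
  qed
  also have "N * (N - N / K) * (N / K) = (K - 1) * (K * q ^ 3 + 3 * q ^ 2 * r + (3 * q * r) * (r / K) + r * (r / K) ^ 2)"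
  proof -
    have cube: "K * (q + x) ^ 3 = K * q ^ 3 + 3 * q ^ 2 * (K * x) + 3 * q * (K * x) * x + (K * x) * x ^ 2" for x
      by (simp add: power3_eq_cube power2_eq_square algebra_simps)
    define y where "y = N / K"
    have y: "y = q + r / K" using K by (simp add: y_def Nq field_simps)
    have "N = K * y" using K by (simp add: y_def)
    then have "N * (N - N / K) * (N / K) = (K - 1) * (K * y ^ 3)"
      unfolding y_def [symmetric] by (simp add: algebra_simps power3_eq_cube)
    also have "y ^ 3 = (q + r / K) ^ 3" unfolding y ..
    finally have "N * (N - N / K) * (N / K) = (K - 1) * (K * (q + r / K) ^ 3)" .
    also have "K * (q + r / K) ^ 3 = K * q ^ 3 + 3 * q ^ 2 * (K * (r / K)) + 3 * q * (K * (r / K)) * (r / K) + (K * (r / K)) * (r / K) ^ 2"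
      by (rule cube)
    also have "K * (r / K) = r" using K by simp
    finally show ?thesis .
  qed
  also have "\<dots> \<le> (K - 1) * (K * q ^ 3 + 3 * q ^ 2 * r + 4 * N)"
  proof -
    have rK: "0 \<le> r / K" "r / K \<le> 1" using r K by auto
    have "(3 * q * r) * (r / K) \<le> (3 * q * r) * 1" using rK q r by (intro mult_left_mono) auto
    moreover have "q * r \<le> q * K" using q r by (intro mult_left_mono) auto
    moreover have "r * (r / K) ^ 2 \<le> r * 1" using rK r by (intro mult_left_mono power_le_one) auto
    moreover have "0 \<le> q * K" using q K by simp
    ultimately have "(3 * q * r) * (r / K) + r * (r / K) ^ 2 \<le> 4 * N" unfolding Nq using r by (simp add: algebra_simps)
    then show ?thesis using K by (intro mult_left_mono) auto
  qed
  finally have "2 * real (t2 n k) * N - 4 * (real (t2 n k))\<^sup>2 / N \<le>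
      6 * real (s_max n k) + (K - 1) * (4 * N) + K * N" using low by (simp add: algebra_simps)
  moreover have "(K - 1) * (4 * N) + K * N \<le> 5 * K * N" using N by (simp add: algebra_simps)
  ultimately show ?thesis unfolding N_def K_def by linarith
qed

context cancellative_3graph
begin

text \<open>\<open>e\<close> is taken as large as the requirement
  \<open>X \<ge> 100 * real k * e\<close> permits, with equality for X = n / k.\<close>

lemma near_extremal_if_slack:
  assumes k: "k \<ge> 3" and n: "n = card V" and large: "4 * 10 ^ 12 * real k ^ 10 \<le> n"
    and m: "card (shadow H) = t2 n k"
    and slack: "2 * real (t2 n k) * n - 4 * (real (t2 n k))\<^sup>2 / n - 6 * real (card H) \<le> 5 * real k * n"
  shows "near_extremal V H k (n / k) (n / (100 * real k ^ 2))"
proof -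
  define K N where "K = real k" and "N = real n"
  define X e where "X = N / K" and "e = N / (100 * K ^ 2)"
  define D where "D = 2 * real (t2 n k) / N"
  have K: "K \<ge> 3" using k by (simp add: K_def)
  have large': "4 * 10 ^ 12 * K ^ 10 \<le> N" using large by (simp add: K_def N_def)
  have pow: "K ^ i \<le> K ^ 10" if "i \<le> 10" for i using that K by (intro power_increasing) auto
  have N1: "200000 * K ^ 5 \<le> N" "200 * K ^ 3 \<le> N" "1 \<le> N"
    using large' pow[of 5] pow[of 3] pow[of 0] by simp_all
  then have n0: "n > 0" by (simp add: N_def)
  have Xe: "X = 100 * K * e" using K by (simp add: X_def e_def field_simps power2_eq_square)
  have e0: "e > 0" using N1(3) K by (simp add: e_def)
  have eX: "e \<le> X" using mult_right_mono[of 1 "100 * K" e] K e0 by (simp add: Xe)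
  define f where "f = (\<lambda>(u, v). (real (card (nonadj v)) - real (card (co u v)))\<^sup>2 / real (card (nonadj v)))"
  have st: "(\<Sum>v\<in>V. (N - real (card (nonadj v)) - D)\<^sup>2) + (\<Sum>p\<in>adj_pairs. f p) / 2 \<le> 5 * K * N"
    using stability[of "real (t2 n k)" D] n0 slack unfolding m n [symmetric] f_def D_def K_def N_def
    by (simp add: case_prod_unfold)
  have f0: "0 \<le> f p" for p by (simp add: f_def case_prod_unfold)
  then have s0: "0 \<le> (\<Sum>p\<in>adj_pairs. f p)" by (simp add: sum_nonneg)
  have s1: "0 \<le> (\<Sum>v\<in>V. (N - real (card (nonadj v)) - D)\<^sup>2)" by (simp add: sum_nonneg)
  \<comment> \<open>A single term of the variance is at most the whole slack 5 K N, so each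
    \<open>nonadj v\<close> is within e / 2 of the average size. The other e / 2 is reserved for the
    distance from that average to \<open>X\<close>.\<close>
  have KN: "5 * K * N \<le> (e / 2)\<^sup>2"
  proof -
    have "5 * K * N * (40000 * K ^ 4) = N * (200000 * K ^ 5)" by (simp add: algebra_simps eval_nat_numeral)
    also have "\<dots> \<le> N * N" using N1 by (intro mult_left_mono) auto
    finally have "5 * K * N \<le> N * N / (40000 * K ^ 4)" using K by (simp add: pos_le_divide_eq)
    also have "\<dots> = (e / 2)\<^sup>2" by (simp add: e_def power2_eq_square eval_nat_numeral)
    finally show ?thesis .
  qed
  have close: "\<bar>real (card (nonadj v)) - X\<bar> \<le> e" if v: "v \<in> V" for v
  proof -
    have "(N - real (card (nonadj v)) - D)\<^sup>2 \<le> (\<Sum>v\<in>V. (N - real (card (nonadj v)) - D)\<^sup>2)"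
      using v by (intro member_le_sum) auto
    also have "\<dots> \<le> (e / 2)\<^sup>2" using st s0 KN by linarith
    finally have 1: "\<bar>N - real (card (nonadj v)) - D\<bar> \<le> e / 2"
      using e0 by (simp add: abs_le_square_iff [symmetric])
    have "K / N \<le> e / 2"
    proof -
      have "200 * K ^ 3 * 1 \<le> N * N" using N1 K by (intro mult_mono) auto
      then have "K * (200 * K ^ 2) \<le> N * N" by (simp add: power2_eq_square power3_eq_cube)
      then have "K \<le> N * N / (200 * K ^ 2)" using K by (simp add: pos_le_divide_eq)
      then have "K / N \<le> N * N / (200 * K ^ 2) / N" using N1 by (intro divide_right_mono) auto
      also have "\<dots> = e / 2" using N1 by (simp add: e_def)
      finally show ?thesis .
    qed
    then have "\<bar>N - D - X\<bar> \<le> e / 2"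
      using turan_degree[OF k n0] unfolding D_def X_def K_def N_def by linarith
    then show ?thesis using 1 by linarith
  qed
  define B where "B = {(u, v) \<in> adj_pairs. real (card (co u v)) < X - 2 * e}"
  have B: "B \<subseteq> adj_pairs" by (auto simp: B_def)
  \<comment> \<open>For a bad pair the codegree and the size of \<open>nonadj v\<close> differ by at
    least \<open>e\<close>, and that size is at most \<open>X + e \<le> 2 * X\<close>. The cost is
    at least N / (20000 K^3) per bad pair, out of a total of 10 K N; hence the bound 200000 K^4
    below.\<close>
  have fB: "e\<^sup>2 / (2 * X) \<le> f p" if p: "p \<in> B" for p
  proof -
    obtain u v where uv: "p = (u, v)" by (rule prod.exhaust)
    then have c: "real (card (co u v)) < X - 2 * e" and v: "v \<in> V"
      using p adjD by (auto simp: B_def adj_pairs_def)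
    have a: "X - e \<le> real (card (nonadj v))" "real (card (nonadj v)) \<le> X + e" using close[OF v] by linarith+
    have "e\<^sup>2 \<le> (real (card (nonadj v)) - real (card (co u v)))\<^sup>2" using c a e0 by (intro power_mono) auto
    then show ?thesis unfolding f_def uv using a eX card_nonadj_pos[OF v] by (auto intro!: frac_le)
  qed
  have "real (card B) * (e\<^sup>2 / (2 * X)) = (\<Sum>p\<in>B. e\<^sup>2 / (2 * X))" by simp
  also have "\<dots> \<le> (\<Sum>p\<in>B. f p)" using fB by (rule sum_mono)
  also have "\<dots> \<le> (\<Sum>p\<in>adj_pairs. f p)" using B f0 by (intro sum_mono2) auto
  also have "\<dots> \<le> 10 * K * N" using st s1 by linarith
  finally have "real (card B) * (e\<^sup>2 / (2 * X)) \<le> 10 * K * N" .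
  then have "real (card B) * e\<^sup>2 \<le> 10 * K * N * (2 * X)"
    using e0 eX by (simp add: field_simps)
  also have "\<dots> = 200000 * K ^ 4 * e\<^sup>2"
    using K by (simp add: X_def e_def field_simps eval_nat_numeral)
  finally have "real (card B) \<le> 200000 * K ^ 4" using e0 by simp
  then have "(real (card B))\<^sup>2 \<le> (200000 * K ^ 4)\<^sup>2" by (intro power_mono) auto
  also have "\<dots> \<le> e"
  proof -
    have "(200000 * K ^ 4)\<^sup>2 * (100 * K ^ 2) = 4 * 10 ^ 12 * K ^ 10"
      by (simp add: power_mult_distrib power_mult [symmetric] power_add [symmetric])
    then show ?thesis using large' K by (simp add: e_def pos_le_divide_eq)
  qed
  finally have few: "(real (card B))\<^sup>2 \<le> e" .
  have "near_extremal V H k X e"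
  proof unfold_locales
    show "real (card V) = k * X" using K by (simp add: X_def N_def K_def n)
    show "100 * real k * e \<le> X" by (simp add: Xe K_def)
  qed (use k e0 close few in \<open>auto simp: B_def\<close>)
  then show ?thesis by (simp add: X_def e_def K_def N_def)
qed

end

theorem theorem1p7:
  fixes k :: nat
  assumes "k \<ge> 3" and "k mod 6 = 1 \<or> k mod 6 = 3"
  shows "\<exists>n0. \<forall>n\<ge>n0. \<forall>(V :: 'a set) H.
    three_graph V H \<and> card V = n \<and> cancellative H \<and> card (shadow H) = t2 n k \<longrightarrow>
      card H \<le> s_max n k \<and>
      (card H = s_max n k \<longrightarrow>
        (\<exists>(W :: nat set) S. steiner_triple_system k W S \<and> blowup V H W S))"
\<comment> \<open>The threshold says exactly that (200000 k^4)^2, the bound on the squared number of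
  bad pairs, is at most e = n / (100 k^2).\<close>
proof (intro exI[of _ "4 * 10 ^ 12 * k ^ 10"] allI impI)
  fix n and V :: "'a set" and H
  assume n: "4 * 10 ^ 12 * k ^ 10 \<le> n"
    and H: "three_graph V H \<and> card V = n \<and> cancellative H \<and> card (shadow H) = t2 n k"
  obtain W0 :: "(nat \<times> nat) set" and S0 where S0: "steiner_triple_system k W0 S0"
    using kirkman[OF assms(2)] by blast
  have large: "4 * 10 ^ 12 * real k ^ 10 \<le> n"
  proof -
    have "real (4 * 10 ^ 12 * k ^ 10) \<le> real n" using n by (simp only: of_nat_le_iff)
    then show ?thesis by simp
  qed
  have "0 < 4 * 10 ^ 12 * k ^ 10" using assms(1) by simp
  then have n0: "n > 0" using n by (rule order_less_le_trans)
  show "card H \<le> s_max n k \<and> (card H = s_max n k \<longrightarrow>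
      (\<exists>(W :: nat set) S. steiner_triple_system k W S \<and> blowup V H W S))"
  proof (cases "card H < s_max n k")
    case False
    interpret cancellative_3graph V H using H by unfold_locales auto
    have "2 * real (t2 n k) * n - 4 * (real (t2 n k))\<^sup>2 / n - 6 * real (card H) \<le> 5 * real k * n"
      using turan_slack[OF assms(1) S0 n0] False by linarith
    then have "near_extremal V H k (n / k) (n / (100 * real k ^ 2))"
      using near_extremal_if_slack[of k n] assms(1) large H by simp
    then interpret near_extremal V H k "n / k" "n / (100 * real k ^ 2)" .
    obtain g :: "_ \<Rightarrow> nat" where g: "bij_betw g (cls ` V) {0..<card (cls ` V)}"
      using ex_bij_betw_finite_nat[of "cls ` V"] by auto
    have sub: "\<Union>triples \<subseteq> cls ` V"
      using triples_steiner by (auto simp: steiner_triple_system_def three_graph_def)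
    have "blowup V H (cls ` V) triples \<longrightarrow> (\<exists>(W :: nat set) S. steiner_triple_system k W S \<and> blowup V H W S)"
      using steiner_triple_system_image[OF triples_steiner g] blowup_image_target[OF _ g sub] by blast
    then show ?thesis using near_extremal_bound H by simp
  qed simp
qed

end
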